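(* Let $S\subseteq\mathbb N^d$ be a good semigroup and let $\omega=(w_1,\dots,w_d)\in S$ be a nonzero element with $w_1\ge w_2\ge\cdots\ge w_d$. For $k=1,\dots,d$ set $s_k=\sum_{j=1}^k w_j$. Let $E=\omega+S$ (a good ideal of $S$, with conductor $c_E$), let $A=S\setminus E$ (the Apéry set of $S$ with respect to $\omega$), and let $A=A_1\cup\cdots\cup A_N$ be the partition of $A$ into levels. Then for every $k\in\{1,\dots,d\}$ and every $i\in\{1,\dots,N\}$, the level $A_i$ contains some subspace of dimension $d-k$ if and only if $i\ge N-s_k+1$. In particular $N=s_d=\sum_{i=1}^d w_i$.
   Context: $\mathbb N$ denotes the nonnegative integers, $I=\{1,\dots,d\}$, $\le$ is the componentwise partial order on $\mathbb N^d$, $\alpha\wedge\beta$ is the componentwise minimum, and for $F\subseteq I$, $\widehat F=I\setminus F$. A good semigroup is a submonoid $S$ of $(\mathbb N^d,+)$ such that (G1) $\alpha\wedge\beta\in S$ for all $\alpha,\beta\in S$; (G2) if $\alpha,\beta\in S$, $\alpha\neq\beta$ and $\alpha_i=\beta_i$ for some $i$, then there is $\epsilon\in S$ with $\epsilon_i>\alpha_i$ and $\epsilon_j\ge\min(\alpha_j,\beta_j)$ for all $j\ne i$, with equality whenever $\alpha_j\ne\beta_j$; (G3) there is $c\in S$ with $c+\mathbb N^d\subseteq S$. A good ideal of $S$ is a subset $E\subseteq S$ with $E+S\subseteq E$ satisfying (G1) and (G2) with all elements taken in $E$; its conductor is $c_E=\min\{\alpha\in\mathbb N^d:\alpha+\mathbb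 N^d\subseteq E\}$. For $X\subseteq\mathbb N^d$, $F\subseteq I$, $\alpha\in\mathbb N^d$: $\Delta^X_F(\alpha)=\{\beta\in X:\beta_i=\alpha_i\ (i\in F),\ \beta_j>\alpha_j\ (j\notin F)\}$ and $\widetilde\Delta^X_F(\alpha)=\{\beta\in X:\beta_i=\alpha_i\ (i\in F),\ \beta_j\ge\alpha_j\ (j\notin F)\}\setminus\{\alpha\}$; superscript omitted when $X=\mathbb N^d$. Levels: let $E\subsetneq S$ be a proper good ideal and $A=S\setminus E$. Write $\alpha\ll\beta$ if $\alpha_i<\beta_i$ for all $i$. For $Y\subseteq S$, an element $\alpha$ is a complete infimum of $r$ elements of $Y$ if there are $r\ge 2$ elements $\beta^{(1)},\dots,\beta^{(r)}\in Y$ and nonempty sets $F_1,\dots,F_r\subsetneq I$ with $\beta^{(j)}\in\Delta^S_{F_j}(\alpha)$, $\beta^{(j)}\wedge\beta^{(k)}=\alpha$ for all $j\ne k$, and $F_1\cap\cdots\cap F_r=\emptyset$. Inductively for $i\ge1$: $B^{(i)}$ is the set of $\alpha\in A\setminus(D^{(1)}\cup\cdots\cup D^{(i-1)})$ such that no $\beta$ in this set satisfies $\alpha\ll\beta$; $C^{(i)}$ is the set of $\alpha\in B^{(i)}$ that are complete infima of $r$ elements of $B^{(i)}$ for some $2\le r\le d$; $D^{(i)}=B^{(i)}\setminus C^{(i)}$. These are pairwise disjoint and there is $N$ with $A=D^{(1)}\cup\cdots\cup D^{(N)}$ (all nonempty); the levels are $A_i:=D^{(N+1-i)}$, $i=1,\dots,N$.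 Subspaces: for nonempty $U\subseteq I$ and $\alpha\in\mathbb N^d$ with $\alpha_j=(c_E)_j$ for all $j\notin U$, the $U$-subspace $\alpha(U)$ is the set $\widetilde\Delta_U(\alpha)=\{\beta\in\mathbb N^d:\beta_i=\alpha_i\ (i\in U),\ \beta_j\ge\alpha_j\ (j\notin U)\}\setminus\{\alpha\}$ if $U\ne I$, and $\{\alpha\}$ if $U=I$; its dimension is $d-|U|$. "$A_i$ contains a subspace of dimension $d-k$" means there are $U\subseteq I$ with $|U|=k$ and such $\alpha$ with $\alpha(U)\subseteq A_i$. *)

theory Defs
  imports Main "HOL-Library.Function_Algebras" "HOL-Library.Set_Algebras"
begin

text \<open>
  A vector of \<open>\<nat>\<^sup>d\<close> is a function \<open>nat \<Rightarrow> nat\<close> that vanishes outside the index set \<open>{1..d}\<close>.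
  Thus \<open>+\<close>, \<open>0\<close>, \<open>\<le>\<close> and \<open>inf\<close> (the componentwise minimum) are the
  library's pointwise operations on functions, and \<open>c +o X\<close> is the translate \<open>c + X\<close>.
\<close>

definition Nvec :: "nat \<Rightarrow> (nat \<Rightarrow> nat) set" where
  "Nvec d = {\<alpha>. \<forall>i. i \<notin> {1..d} \<longrightarrow> \<alpha> i = 0}"

definition property_G1 :: "(nat \<Rightarrow> nat) set \<Rightarrow> bool" where
  "property_G1 X \<longleftrightarrow> (\<forall>\<alpha>\<in>X. \<forall>\<beta>\<in>X. inf \<alpha> \<beta> \<in> X)"

definition property_G2 :: "nat \<Rightarrow> (nat \<Rightarrow> nat) set \<Rightarrow> bool" where
  "property_G2 d X \<longleftrightarrow>
     (\<forall>\<alpha>\<in>X. \<forall>\<beta>\<in>X. \<forall>i\<in>{1..d}. \<alpha> \<noteq> \<beta> \<and> \<alpha> i = \<beta> i \<longrightarrow>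
        (\<exists>\<epsilon>\<in>X. \<epsilon> i > \<alpha> i \<and>
           (\<forall>j\<in>{1..d} - {i}. \<epsilon> j \<ge> min (\<alpha> j) (\<beta> j) \<and>
              (\<alpha> j \<noteq> \<beta> j \<longrightarrow> \<epsilon> j = min (\<alpha> j) (\<beta> j)))))"

definition property_G3 :: "nat \<Rightarrow> (nat \<Rightarrow> nat) set \<Rightarrow> bool" where
  "property_G3 d X \<longleftrightarrow> (\<exists>c\<in>X. c +o Nvec d \<subseteq> X)"

definition good_semigroup :: "nat \<Rightarrow> (nat \<Rightarrow> nat) set \<Rightarrow> bool" where
  "good_semigroup d S \<longleftrightarrow>
     S \<subseteq> Nvec d \<and> 0 \<in> S \<and> (\<forall>\<alpha>\<in>S. \<forall>\<beta>\<in>S. \<alpha> + \<beta> \<in> S) \<and>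
     property_G1 S \<and> property_G2 d S \<and> property_G3 d S"

text \<open>\<open>LEAST\<close> is taken with respect to the componentwise partial order: a minimum, not merely
  a minimal element.\<close>

definition conductor :: "nat \<Rightarrow> (nat \<Rightarrow> nat) set \<Rightarrow> nat \<Rightarrow> nat" where
  "conductor d E = (LEAST \<alpha>. \<alpha> \<in> Nvec d \<and> \<alpha> +o Nvec d \<subseteq> E)"

definition Delta :: "nat \<Rightarrow> (nat \<Rightarrow> nat) set \<Rightarrow> nat set \<Rightarrow> (nat \<Rightarrow> nat) \<Rightarrow> (nat \<Rightarrow> nat) set" where
  "Delta d X F \<alpha> = {\<beta>\<in>X. (\<forall>i\<in>F. \<beta> i = \<alpha> i) \<and> (\<forall>j\<in>{1..d} - F. \<beta> j > \<alpha> j)}"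

definition Delta_tilde :: "nat \<Rightarrow> (nat \<Rightarrow> nat) set \<Rightarrow> nat set \<Rightarrow> (nat \<Rightarrow> nat) \<Rightarrow> (nat \<Rightarrow> nat) set" where
  "Delta_tilde d X F \<alpha> =
     {\<beta>\<in>X. (\<forall>i\<in>F. \<beta> i = \<alpha> i) \<and> (\<forall>j\<in>{1..d} - F. \<beta> j \<ge> \<alpha> j)} - {\<alpha>}"

definition strictly_below :: "nat \<Rightarrow> (nat \<Rightarrow> nat) \<Rightarrow> (nat \<Rightarrow> nat) \<Rightarrow> bool" where
  "strictly_below d \<alpha> \<beta> \<longleftrightarrow> (\<forall>i\<in>{1..d}. \<alpha> i < \<beta> i)"

definition complete_infimum ::
  "nat \<Rightarrow> (nat \<Rightarrow> nat) set \<Rightarrow> (nat \<Rightarrow> nat) set \<Rightarrow> nat \<Rightarrow> (nat \<Rightarrow> nat) \<Rightarrow> bool" where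
  "complete_infimum d S Y r \<alpha> \<longleftrightarrow> r \<ge> 2 \<and>
     (\<exists>(\<beta> :: nat \<Rightarrow> nat \<Rightarrow> nat) (F :: nat \<Rightarrow> nat set).
        (\<forall>j\<in>{1..r}. \<beta> j \<in> Y \<and> F j \<noteq> {} \<and> F j \<subset> {1..d} \<and> \<beta> j \<in> Delta d S (F j) \<alpha>) \<and>
        (\<forall>j\<in>{1..r}. \<forall>k\<in>{1..r}. j \<noteq> k \<longrightarrow> inf (\<beta> j) (\<beta> k) = \<alpha>) \<and>
        (\<Inter>j\<in>{1..r}. F j) = {})"

text \<open>
  For \<open>R = A - (D\<^sup>1 \<union> \<dots> \<union> D\<^sup>i\<^sup>-\<^sup>1)\<close>, the sets \<open>B\<close> and \<open>C\<close> below are the sets written \<open>B\<close> and \<open>C\<close>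
  with upper index \<open>i\<close> in the inductive construction of the levels of \<open>A = S - E\<close>.
\<close>

definition B_part :: "nat \<Rightarrow> (nat \<Rightarrow> nat) set \<Rightarrow> (nat \<Rightarrow> nat) set" where
  "B_part d R = {\<alpha>\<in>R. \<not> (\<exists>\<beta>\<in>R. strictly_below d \<alpha> \<beta>)}"

definition C_part :: "nat \<Rightarrow> (nat \<Rightarrow> nat) set \<Rightarrow> (nat \<Rightarrow> nat) set \<Rightarrow> (nat \<Rightarrow> nat) set" where
  "C_part d S R = {\<alpha>\<in>B_part d R. \<exists>r\<in>{2..d}. complete_infimum d S (B_part d R) r \<alpha>}"

fun D_part :: "nat \<Rightarrow> (nat \<Rightarrow> nat) set \<Rightarrow> (nat \<Rightarrow> nat) set \<Rightarrow> nat \<Rightarrow> (nat \<Rightarrow> nat) set" where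
  "D_part d S E i =
     (let R = (S - E) - (\<Union>j\<in>{1..<i}. D_part d S E j) in B_part d R - C_part d S R)"

declare D_part.simps [simp del]

definition num_levels :: "nat \<Rightarrow> (nat \<Rightarrow> nat) set \<Rightarrow> (nat \<Rightarrow> nat) set \<Rightarrow> nat" where
  "num_levels d S E =
     (THE N. S - E = (\<Union>i\<in>{1..N}. D_part d S E i) \<and> (\<forall>i\<in>{1..N}. D_part d S E i \<noteq> {}))"

text \<open>Only meaningful for \<open>1 \<le> i \<le> num_levels d S E\<close>.\<close>

definition level :: "nat \<Rightarrow> (nat \<Rightarrow> nat) set \<Rightarrow> (nat \<Rightarrow> nat) set \<Rightarrow> nat \<Rightarrow> (nat \<Rightarrow> nat) set" where
  "level d S E i = D_part d S E (num_levels d S E + 1 - i)"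

definition U_subspace :: "nat \<Rightarrow> nat set \<Rightarrow> (nat \<Rightarrow> nat) \<Rightarrow> (nat \<Rightarrow> nat) set" where
  "U_subspace d U \<alpha> = (if U = {1..d} then {\<alpha>} else Delta_tilde d (Nvec d) U \<alpha>)"

definition contains_subspace ::
  "nat \<Rightarrow> (nat \<Rightarrow> nat) set \<Rightarrow> (nat \<Rightarrow> nat) set \<Rightarrow> nat \<Rightarrow> bool" where
  "contains_subspace d E X n \<longleftrightarrow>
     (\<exists>U \<alpha>. U \<noteq> {} \<and> U \<subseteq> {1..d} \<and> n = d - card U \<and>
        \<alpha> \<in> Nvec d \<and> (\<forall>j\<in>{1..d} - U. \<alpha> j = conductor d E j) \<and>
        U_subspace d U \<alpha> \<subseteq> X)"

end

theory Submission
  imports Defs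
begin

text \<open>
  For a set \<open>X\<close> with property (G2), the number of unit steps \<open>\<gamma> \<rightarrow> \<gamma> + e\<^sub>i\<close> on a monotone path that are
  effective for \<open>X\<close> (some \<open>\<beta> \<ge> \<gamma>\<close> in \<open>X\<close> has \<open>\<beta>\<^sub>i = \<gamma>\<^sub>i\<close>) depends only on the end points; it plays the
  role of a length. Let \<open>g\<close> be this height for \<open>S\<close> minus the height for \<open>E\<close>: it is monotone, grows by
  at most one per step and is constant beyond the conductor \<open>c\<close> of \<open>E\<close>. From an element of
  \<open>A = S - E\<close> some step increases \<open>g\<close>, so \<open>g\<close> increases strictly along \<open>\<lless>\<close> and a complete infimum
  has smaller \<open>g\<close> than one of its constituents; conversely the covers of \<open>\<alpha>\<close> in \<open>S\<close>
  exhibit \<open>\<alpha>\<close> as a complete infimum unless something in \<open>A\<close> with \<open>g \<le> g \<alpha> + 1\<close> lies strictly above it. Hence the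
  levels are the level sets of \<open>g\<close> on \<open>A\<close>, and \<open>N = g c\<close>.

  For \<open>E = \<omega> + S\<close> the height for \<open>E\<close> at \<open>\<gamma>\<close> is the height for \<open>S\<close> at \<open>\<gamma> - \<omega>\<close>, so at the point with
  coordinates \<open>0\<close> on \<open>U\<close> and \<open>c\<close> off \<open>U\<close> the value of \<open>g\<close> is the sum of \<open>\<omega>\<close> over the complement of \<open>U\<close>.
  This is the least value of \<open>g\<close> on any \<open>U\<close>-subspace, and every value from there up to \<open>N - 1\<close> is
  attained by a \<open>U\<close>-subspace contained in \<open>A\<close>.
\<close>

section \<open>Vectors\<close>

abbreviation bump :: "nat \<Rightarrow> (nat \<Rightarrow> nat) \<Rightarrow> nat \<Rightarrow> nat" where
  "bump i \<gamma> \<equiv> \<gamma>(i := Suc (\<gamma> i))"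

lemma Nvec_D: "\<gamma> \<in> Nvec d \<Longrightarrow> i \<notin> {1..d} \<Longrightarrow> \<gamma> i = 0"
  unfolding Nvec_def by blast

lemma Nvec_upd: "\<gamma> \<in> Nvec d \<Longrightarrow> i \<in> {1..d} \<Longrightarrow> \<gamma>(i := m) \<in> Nvec d"
  unfolding Nvec_def by auto

lemma Nvec_mono: "\<gamma> \<le> \<delta> \<Longrightarrow> \<delta> \<in> Nvec d \<Longrightarrow> \<gamma> \<in> Nvec d"
  unfolding Nvec_def mem_Collect_eq le_fun_def by (metis le_zero_eq)

lemma Nvec_sup: "\<gamma> \<in> Nvec d \<Longrightarrow> \<delta> \<in> Nvec d \<Longrightarrow> sup \<gamma> \<delta> \<in> Nvec d"
  unfolding Nvec_def by auto

lemma Nvec_leI: "\<gamma> \<in> Nvec d \<Longrightarrow> (\<And>i. i \<in> {1..d} \<Longrightarrow> \<gamma> i \<le> \<delta> i) \<Longrightarrow> \<gamma> \<le> \<delta>"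
  by (rule le_funI) (metis Nvec_D le0)

lemma Nvec_eqI:
  "\<gamma> \<in> Nvec d \<Longrightarrow> \<delta> \<in> Nvec d \<Longrightarrow> (\<And>i. i \<in> {1..d} \<Longrightarrow> \<gamma> i = \<delta> i) \<Longrightarrow> \<gamma> = \<delta>"
  by (rule ext) (metis Nvec_D)

lemma le_bump: "\<gamma> \<le> bump i \<gamma>"
  by (simp add: le_fun_def)

lemma bump_le_iff: "bump i \<gamma> \<le> \<delta> \<longleftrightarrow> \<gamma> \<le> \<delta> \<and> \<gamma> i < \<delta> i"
proof
  assume "bump i \<gamma> \<le> \<delta>"
  then show "\<gamma> \<le> \<delta> \<and> \<gamma> i < \<delta> i"
    using le_bump order_trans le_funD[of "bump i \<gamma>" \<delta> i] by fastforce
next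
  assume h: "\<gamma> \<le> \<delta> \<and> \<gamma> i < \<delta> i"
  show "bump i \<gamma> \<le> \<delta>"
  proof (rule le_funI)
    show "bump i \<gamma> j \<le> \<delta> j" for j
      using h le_funD[of \<gamma> \<delta> j] by (cases "j = i") auto
  qed
qed

text \<open>Comparisons of heights follow a monotone path of unit steps; the induction is on the
  coordinate distance still left to \<delta>.\<close>

lemma path_induct [consumes 2, case_names base step]:
  assumes "\<gamma> \<le> \<delta>" and "\<delta> \<in> Nvec d" and base: "P \<gamma>"
    and step: "\<And>\<xi> i. \<xi> \<in> Nvec d \<Longrightarrow> i \<in> {1..d} \<Longrightarrow> \<gamma> \<le> \<xi> \<Longrightarrow> bump i \<xi> \<le> \<delta> \<Longrightarrow> P \<xi> \<Longrightarrow> P (bump i \<xi>)"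
  shows "P \<delta>"
proof -
  have "P \<delta>" if "\<gamma> \<le> \<xi>" "\<xi> \<le> \<delta>" "P \<xi>" "(\<Sum>i\<in>{1..d}. \<delta> i - \<xi> i) = n" for \<xi> n
    using that
  proof (induction n arbitrary: \<xi> rule: less_induct)
    case (less n)
    show ?case
    proof (cases "\<xi> = \<delta>")
      case True
      then show ?thesis using less.prems by simp
    next
      case False
      have \<xi>: "\<xi> \<in> Nvec d" using less.prems assms(2) Nvec_mono by blast
      then obtain i where i: "i \<in> {1..d}" "\<xi> i \<noteq> \<delta> i"
        using False assms(2) Nvec_eqI by blast
      then have lt: "\<xi> i < \<delta> i"
        using less.prems(2) by (simp add: le_fun_def order_le_neq_trans)
      then have le: "bump i \<xi> \<le> \<delta>" using less.prems(2) bump_le_iff by blast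
      have "(\<Sum>j\<in>{1..d}. \<delta> j - bump i \<xi> j) < (\<Sum>j\<in>{1..d}. \<delta> j - \<xi> j)"
        by (rule sum_strict_mono_ex1) (use i(1) lt in \<open>auto intro!: bexI[of _ i]\<close>)
      moreover have "P (bump i \<xi>)"
        using step[OF \<xi> i(1) less.prems(1) le less.prems(3)] .
      moreover have "\<gamma> \<le> bump i \<xi>" using less.prems(1) le_bump order_trans by blast
      ultimately show ?thesis using less.IH le less.prems(4) by blast
    qed
  qed
  then show ?thesis using assms(1) base by blast
qed

text \<open>A member of minimal coordinate sum works: its infimum with a member not above it would
  have a smaller sum.\<close>

lemma inf_closed_has_least:
  assumes sub: "Y \<subseteq> Nvec d" and ne: "Y \<noteq> {}"
    and inf: "\<And>\<alpha> \<beta>. \<alpha> \<in> Y \<Longrightarrow> \<beta> \<in> Y \<Longrightarrow> inf \<alpha> \<beta> \<in> Y"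
  shows "\<exists>\<mu>\<in>Y. \<forall>\<beta>\<in>Y. \<mu> \<le> \<beta>"
proof -
  obtain \<mu> where \<mu>: "\<mu> \<in> Y" "\<And>\<beta>. \<beta> \<in> Y \<Longrightarrow> (\<Sum>i\<in>{1..d}. \<mu> i) \<le> (\<Sum>i\<in>{1..d}. \<beta> i)"
    using ne ex_has_least_nat[of "\<lambda>\<mu>. \<mu> \<in> Y" _ "\<lambda>\<mu>. \<Sum>i\<in>{1..d}. \<mu> i"] by blast
  have "\<mu> \<le> \<beta>" if "\<beta> \<in> Y" for \<beta>
  proof (rule ccontr)
    assume "\<not> \<mu> \<le> \<beta>"
    then obtain i where "i \<in> {1..d}" "\<beta> i < \<mu> i"
      using \<mu>(1) sub Nvec_leI not_le by blast
    then have "(\<Sum>i\<in>{1..d}. inf \<mu> \<beta> i) < (\<Sum>i\<in>{1..d}. \<mu> i)"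
      by (intro sum_strict_mono_ex1) (auto intro!: bexI[of _ i] simp: inf_nat_def)
    then show False using \<mu>(2)[OF inf[OF \<mu>(1) that]] by simp
  qed
  then show ?thesis using \<mu>(1) by blast
qed

section \<open>The height function of a set with property (G2)\<close>

text \<open>Integer valued, since heights are later subtracted and telescoped.\<close>

definition step :: "(nat \<Rightarrow> nat) set \<Rightarrow> nat \<Rightarrow> (nat \<Rightarrow> nat) \<Rightarrow> int" where
  "step X i \<gamma> = of_bool (\<exists>\<beta>\<in>X. \<gamma> \<le> \<beta> \<and> \<beta> i = \<gamma> i)"

text \<open>The number of effective steps on the path from \<open>0\<close> to \<open>\<gamma>\<close> that exhausts the coordinates
  in increasing order; by \<open>height_bump\<close> every other monotone path gives the same number.\<close>

definition height :: "nat \<Rightarrow> (nat \<Rightarrow> nat) set \<Rightarrow> (nat \<Rightarrow> nat) \<Rightarrow> int" where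
  "height d X \<gamma> = (\<Sum>i\<in>{1..d}. \<Sum>m<\<gamma> i. step X i (\<lambda>j. if j < i then \<gamma> j else if j = i then m else 0))"

lemma step_nonneg: "0 \<le> step X i \<gamma>"
  and step_le_1: "step X i \<gamma> \<le> 1"
  by (simp_all add: step_def)

lemma step_mem: "\<gamma> \<in> X \<Longrightarrow> step X i \<gamma> = 1"
  by (auto simp: step_def)

lemma step_mono: "X \<subseteq> Y \<Longrightarrow> step X i \<gamma> \<le> step Y i \<gamma>"
  by (auto simp: step_def)

text \<open>Let \<delta> witness the first step and \<beta> the second. If \<delta> does not already
  exceed \<gamma> at j, (G2) at j raises that coordinate and keeps coordinate i, where \<delta> and
  \<beta> differ.\<close>

lemma step_square_aux:
  assumes "property_G2 d X" and \<gamma>: "\<gamma> \<in> Nvec d" and ij: "i \<in> {1..d}" "j \<in> {1..d}" "i \<noteq> j"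
    and a: "step X i \<gamma> = 1" and b: "step X j (bump i \<gamma>) = 1"
  shows "step X i (bump j \<gamma>) = 1"
proof -
  obtain \<delta> where \<delta>: "\<delta> \<in> X" "\<gamma> \<le> \<delta>" "\<delta> i = \<gamma> i"
    using a by (auto simp: step_def split: if_splits)
  obtain \<beta> where \<beta>: "\<beta> \<in> X" "bump i \<gamma> \<le> \<beta>" "\<beta> j = \<gamma> j"
    using b ij(3) by (auto simp: step_def split: if_splits)
  show ?thesis
  proof (cases "\<delta> j = \<gamma> j")
    case False
    then have "bump j \<gamma> \<le> \<delta>" using \<delta>(2) by (metis bump_le_iff le_fun_def order_le_neq_trans)
    then show ?thesis using \<delta> ij(3) by (auto simp: step_def)
  next
    case True
    have lt: "\<gamma> \<le> \<beta>" "\<gamma> i < \<beta> i" using \<beta>(2) bump_le_iff by blast+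
    then have "\<delta> \<noteq> \<beta>" using \<delta>(3) by auto
    then obtain \<epsilon> where \<epsilon>: "\<epsilon> \<in> X" "\<epsilon> j > \<delta> j"
      "\<And>k. k \<in> {1..d} - {j} \<Longrightarrow> \<epsilon> k \<ge> min (\<delta> k) (\<beta> k) \<and> (\<delta> k \<noteq> \<beta> k \<longrightarrow> \<epsilon> k = min (\<delta> k) (\<beta> k))"
      using assms(1) \<delta>(1) \<beta>(1,3) ij(2) True unfolding property_G2_def by metis
    have "\<epsilon> i = \<gamma> i" using \<epsilon>(3)[of i] ij lt(2) \<delta>(3) by simp
    moreover have "\<gamma> \<le> \<epsilon>"
    proof (rule Nvec_leI[OF \<gamma>])
      fix k assume k: "k \<in> {1..d}"
      have "\<gamma> k \<le> min (\<delta> k) (\<beta> k)" using \<delta>(2) lt(1) by (simp add: le_fun_def)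
      then show "\<gamma> k \<le> \<epsilon> k" using \<epsilon>(2) \<epsilon>(3)[of k] k True by (cases "k = j") auto
    qed
    ultimately show ?thesis using \<epsilon>(1,2) True ij(3) by (auto simp: step_def bump_le_iff)
  qed
qed

text \<open>Path independence around a unit square. The four steps are Boolean; (G2) enters when
  both steps at \<gamma> are effective.\<close>

lemma step_square:
  assumes "property_G2 d X" and "\<gamma> \<in> Nvec d" and ij: "i \<in> {1..d}" "j \<in> {1..d}" "i \<noteq> j"
  shows "step X i \<gamma> + step X j (bump i \<gamma>) = step X j \<gamma> + step X i (bump j \<gamma>)"
proof -
  have weaken: "step X k (bump l \<gamma>) = 1 \<Longrightarrow> step X k \<gamma> = 1" if "k \<noteq> l" for k l
    using that by (auto simp: step_def bump_le_iff split: if_splits)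
  have other: "step X l (bump k \<gamma>) = 1" if kl: "k \<noteq> l" "step X k \<gamma> = 0" "step X l \<gamma> = 1" for k l
  proof -
    obtain \<beta> where \<beta>: "\<beta> \<in> X" "\<gamma> \<le> \<beta>" "\<beta> l = \<gamma> l" using kl(3) by (auto simp: step_def split: if_splits)
    then have "\<gamma> k < \<beta> k" using kl(2) by (simp add: step_def le_fun_def) (metis order_le_neq_trans)
    then show ?thesis using \<beta> kl(1) by (auto simp: step_def bump_le_iff)
  qed
  have bool: "step X k \<xi> = 0 \<or> step X k \<xi> = 1" for k \<xi> by (simp add: step_def) blast
  show ?thesis
    using step_square_aux[OF assms] step_square_aux[OF assms(1,2) ij(2,1) ij(3)[symmetric]]
      weaken[of i j] weaken[of j i] other[of i j] other[of j i] ij(3)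
      bool[of i \<gamma>] bool[of j \<gamma>] bool[of i "bump j \<gamma>"] bool[of j "bump i \<gamma>"]
    by (smt (verit))
qed

lemma height_bump:
  assumes G2: "property_G2 d X" and "\<gamma> \<in> Nvec d" and "i \<in> {1..d}"
  shows "height d X (bump i \<gamma>) = height d X \<gamma> + step X i \<gamma>"
proof -
  define H where "H n \<gamma> = (\<Sum>i\<in>{1..n}. \<Sum>m<\<gamma> i. step X i (\<lambda>j. if j < i then \<gamma> j else if j = i then m else 0))"
    for n and \<gamma> :: "nat \<Rightarrow> nat"
  \<comment> \<open>On \<open>Nvec d\<close>, \<open>trunc n \<gamma>\<close> is the point the
    defining path reaches after the first n coordinates, and \<open>H n \<gamma>\<close> is the
    height counted up to there.\<close>
  define trunc where "trunc n \<gamma> = (\<lambda>j. if j \<le> n then \<gamma> j else 0)" for n and \<gamma> :: "nat \<Rightarrow> nat"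
  have H_Suc: "H (Suc n) \<gamma> = H n \<gamma> + (\<Sum>m<\<gamma> (Suc n). step X (Suc n) ((trunc n \<gamma>)(Suc n := m)))" for n \<gamma>
  proof -
    have "(\<lambda>j. if j < Suc n then \<gamma> j else if j = Suc n then m else 0) = (trunc n \<gamma>)(Suc n := m)" for m
      by (auto simp: trunc_def)
    then show ?thesis by (simp add: H_def)
  qed
  have "H n (bump i \<gamma>) = H n \<gamma> + step X i (trunc n \<gamma>)" if "i \<in> {1..n}" "n \<le> d" for n
    using that
  proof (induction n)
    case 0
    then show ?case by simp
  next
    case (Suc n)
    define \<tau> where "\<tau> = trunc n \<gamma>"
    define k where "k = Suc n"
    have \<tau>: "\<tau> \<in> Nvec d" using assms(2) by (auto simp: \<tau>_def trunc_def Nvec_def)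
    have \<tau>k: "\<tau> k = 0" by (simp add: \<tau>_def trunc_def k_def)
    have top: "trunc (Suc n) \<gamma> = \<tau>(k := \<gamma> k)" by (auto simp: \<tau>_def trunc_def k_def le_Suc_eq)
    show ?case
    proof (cases "i = Suc n")
      case True
      have "trunc n (bump i \<gamma>) = \<tau>" using True by (auto simp: trunc_def \<tau>_def)
      moreover have "H n (bump i \<gamma>) = H n \<gamma>"
        unfolding H_def using True by (intro sum.cong refl arg_cong2[of _ _ _ _ "step X"]) auto
      ultimately show ?thesis unfolding H_Suc top using True by (simp add: \<tau>_def k_def fun_upd_same del: fun_upd_apply)
    next
      case False
      have i: "i \<in> {1..n}" "i \<noteq> k" "i \<in> {1..d}" "k \<in> {1..d}" using False Suc.prems by (auto simp: k_def)
      have tr: "trunc n (bump i \<gamma>) = bump i \<tau>" using i by (auto simp: trunc_def \<tau>_def)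
      \<comment> \<open>The square identity at each point of column \<open>k\<close> makes the
        change in the column sum telescope.\<close>
      have diff: "step X k ((bump i \<tau>)(k := m)) =
          step X k (\<tau>(k := m)) + (step X i (\<tau>(k := Suc m)) - step X i (\<tau>(k := m)))" for m
        using step_square[OF G2 Nvec_upd[OF \<tau> i(4), of m] i(3,4,2)] i(2) by (simp add: fun_upd_twist)
      have "(\<Sum>m<\<gamma> k. step X k ((bump i \<tau>)(k := m))) =
          (\<Sum>m<\<gamma> k. step X k (\<tau>(k := m))) + (step X i (\<tau>(k := \<gamma> k)) - step X i (\<tau>(k := 0)))"
        unfolding diff sum.distrib
        using sum_lessThan_telescope[of "\<lambda>m. step X i (\<tau>(k := m))" "\<gamma> k"] by simp
      moreover have "\<tau>(k := 0) = \<tau>" using \<tau>k by (simp add: fun_upd_idem)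
      ultimately show ?thesis
        using Suc.IH[OF i(1)] Suc.prems(2) i(2)
        unfolding H_Suc tr top by (simp add: k_def \<tau>_def fun_upd_other del: fun_upd_apply)
    qed
  qed
  moreover have "trunc d \<gamma> = \<gamma>" using assms(2) by (auto simp: trunc_def Nvec_def)
  ultimately show ?thesis using assms(3) by (simp add: H_def height_def)
qed

lemma height_mono:
  assumes "property_G2 d X" and "\<gamma> \<le> \<delta>" and "\<delta> \<in> Nvec d"
  shows "height d X \<gamma> \<le> height d X \<delta>"
  using assms(2,3)
proof (induction rule: path_induct)
  case (step \<xi> i)
  then show ?case using height_bump[OF assms(1) step(1,2)] step_nonneg[of X i \<xi>]
    by (simp del: fun_upd_apply)
qed simp

text \<open>Every step leaving a member of \<open>X\<close> is effective, so the first step of a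
  path to \<delta> already counts.\<close>

lemma height_strict_mono:
  assumes "property_G2 d X" and "\<gamma> \<le> \<delta>" and "\<delta> \<in> Nvec d" and "\<gamma> \<in> X" and "\<gamma> \<noteq> \<delta>"
  shows "height d X \<gamma> < height d X \<delta>"
proof -
  have \<gamma>: "\<gamma> \<in> Nvec d" using assms(2,3) Nvec_mono by blast
  then obtain i where i: "i \<in> {1..d}" "\<gamma> i \<noteq> \<delta> i"
    using assms(3,5) Nvec_eqI by blast
  then have "bump i \<gamma> \<le> \<delta>" using assms(2) i(2) by (metis bump_le_iff le_fun_def order_le_neq_trans)
  then have "height d X (bump i \<gamma>) \<le> height d X \<delta>" using height_mono assms by blast
  then show ?thesis using height_bump[OF assms(1) \<gamma> i(1)] step_mem[OF assms(4)] by simp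
qed

text \<open>An effective step on the way to \<mu> would give an element of \<open>X\<close> above
  \<gamma> that is smaller than \<mu> in one coordinate.\<close>

lemma height_least_above:
  assumes "property_G2 d X" and "\<gamma> \<le> \<mu>" and "\<mu> \<in> Nvec d" and "\<And>\<beta>. \<beta> \<in> X \<Longrightarrow> \<gamma> \<le> \<beta> \<Longrightarrow> \<mu> \<le> \<beta>"
  shows "height d X \<mu> = height d X \<gamma>"
  using assms(2,3)
proof (induction rule: path_induct)
  case (step \<xi> i)
  have "\<not> (\<exists>\<beta>\<in>X. \<xi> \<le> \<beta> \<and> \<beta> i = \<xi> i)"
  proof
    assume "\<exists>\<beta>\<in>X. \<xi> \<le> \<beta> \<and> \<beta> i = \<xi> i"
    then obtain \<beta> where \<beta>: "\<beta> \<in> X" "\<xi> \<le> \<beta>" "\<beta> i = \<xi> i" by blast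
    then have "\<mu> \<le> \<beta>" using assms(4) step(3) order_trans by blast
    then have "\<mu> i \<le> \<xi> i" using \<beta>(3) by (metis le_fun_def)
    then show False using step(4) bump_le_iff by (metis not_le)
  qed
  then have "step X i \<xi> = 0" by (simp add: step_def)
  then show ?case using height_bump[OF assms(1) step(1,2)] step(5) by (simp del: fun_upd_apply)
qed simp

lemma height_full_steps:
  assumes "property_G2 d X" and "\<gamma> \<le> \<delta>" and "\<delta> \<in> Nvec d"
    and full: "\<And>\<xi> i. \<xi> \<in> Nvec d \<Longrightarrow> i \<in> {1..d} \<Longrightarrow> \<gamma> \<le> \<xi> \<Longrightarrow> bump i \<xi> \<le> \<delta> \<Longrightarrow> step X i \<xi> = 1"
  shows "height d X \<delta> = height d X \<gamma> + (\<Sum>i\<in>{1..d}. int (\<delta> i) - int (\<gamma> i))"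
  using assms(2,3)
proof (induction rule: path_induct)
  case (step \<xi> i)
  have "(\<Sum>j\<in>{1..d}. int (bump i \<xi> j) - int (\<gamma> j)) =
      (\<Sum>j\<in>{1..d}. (int (\<xi> j) - int (\<gamma> j)) + of_bool (j = i))"
    by (rule sum.cong) auto
  also have "\<dots> = (\<Sum>j\<in>{1..d}. int (\<xi> j) - int (\<gamma> j)) + 1"
    using step(2) by (simp add: sum.distrib of_bool_def)
  finally show ?case using height_bump[OF assms(1) step(1,2)] full[OF step(1-4)] step(5)
    by (simp del: fun_upd_apply)
qed simp


section \<open>The level function of a difference of good sets\<close>

text \<open>Here \<open>c\<close> is any point beyond which everything lies in \<open>E\<close>; it
  becomes the conductor when subspaces are treated.\<close>

locale nested_good =
  fixes d :: nat and S E :: "(nat \<Rightarrow> nat) set" and c :: "nat \<Rightarrow> nat"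
  assumes S_Nvec: "S \<subseteq> Nvec d" and E_S: "E \<subseteq> S"
    and G1_S: "property_G1 S" and G2_S: "property_G2 d S"
    and G1_E: "property_G1 E" and G2_E: "property_G2 d E"
    and c_Nvec: "c \<in> Nvec d" and above_c: "\<And>\<gamma>. \<gamma> \<in> Nvec d \<Longrightarrow> c \<le> \<gamma> \<Longrightarrow> \<gamma> \<in> E"
begin

section \<open>Monotonicity and jumps of the height difference\<close>

definition g :: "(nat \<Rightarrow> nat) \<Rightarrow> int" where
  "g \<gamma> = height d S \<gamma> - height d E \<gamma>"

lemma g_bump:
  "\<gamma> \<in> Nvec d \<Longrightarrow> i \<in> {1..d} \<Longrightarrow> g (bump i \<gamma>) = g \<gamma> + (step S i \<gamma> - step E i \<gamma>)"
  unfolding g_def using height_bump[OF G2_S] height_bump[OF G2_E] by simp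

lemma g_bump_bounds:
  assumes "\<gamma> \<in> Nvec d" and "i \<in> {1..d}"
  shows "g \<gamma> \<le> g (bump i \<gamma>)" and "g (bump i \<gamma>) \<le> g \<gamma> + 1"
  using g_bump[OF assms] step_mono[OF E_S, of i \<gamma>] step_nonneg[of E i \<gamma>] step_le_1[of S i \<gamma>] by linarith+

lemma g_mono: "\<gamma> \<le> \<delta> \<Longrightarrow> \<delta> \<in> Nvec d \<Longrightarrow> g \<gamma> \<le> g \<delta>"
proof (induction rule: path_induct)
  case (step \<xi> i)
  then show ?case using g_bump_bounds(1)[OF step(1,2)] by linarith
qed simp

lemma g_nonneg: "\<gamma> \<in> Nvec d \<Longrightarrow> 0 \<le> g \<gamma>"
  using g_mono[of "\<lambda>_. 0" \<gamma>] by (simp add: le_fun_def g_def height_def)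

text \<open>Discrete intermediate value theorem: \<open>g\<close> grows by at most one per step, so
  a path cannot skip the jump from t to t + 1.\<close>

lemma g_crossing:
  assumes "\<gamma> \<le> \<delta>" and "\<delta> \<in> Nvec d" and "g \<gamma> \<le> t" and "t < g \<delta>"
  obtains \<xi> i where "\<xi> \<in> Nvec d" "i \<in> {1..d}" "\<gamma> \<le> \<xi>" "bump i \<xi> \<le> \<delta>" "g \<xi> = t" "g (bump i \<xi>) = t + 1"
proof (rule ccontr)
  assume none: "\<not> thesis"
  have "g \<delta> \<le> t"
    using assms(1,2)
  proof (induction rule: path_induct)
    case base
    show ?case by fact
  next
    case (step \<xi> i)
    then show ?case using that[OF step(1-4)] none g_bump_bounds[OF step(1,2)] by linarith
  qed
  then show False using assms(4) by simp
qed

lemma least_above: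
  assumes "X = S \<or> X = E" and "\<gamma> \<in> Nvec d"
  obtains \<mu> where "\<mu> \<in> X" "\<gamma> \<le> \<mu>" "\<And>\<beta>. \<beta> \<in> X \<Longrightarrow> \<gamma> \<le> \<beta> \<Longrightarrow> \<mu> \<le> \<beta>"
proof -
  have "sup \<gamma> c \<in> X" using assms above_c E_S Nvec_sup c_Nvec by fastforce
  moreover have "property_G1 X" "X \<subseteq> Nvec d" using assms(1) G1_S G1_E S_Nvec E_S by auto
  ultimately have "\<exists>\<mu>\<in>{\<beta>\<in>X. \<gamma> \<le> \<beta>}. \<forall>\<beta>\<in>{\<beta>\<in>X. \<gamma> \<le> \<beta>}. \<mu> \<le> \<beta>"
    by (intro inf_closed_has_least[of _ d]) (auto simp: property_G1_def intro!: exI[of _ "sup \<gamma> c"])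
  then show ?thesis using that by blast
qed

text \<open>Leastness in \<open>S\<close> also bounds the elements of \<open>E\<close> above
  \<gamma>, so neither height changes between \<gamma> and \<mu>.\<close>

lemma g_least_above:
  assumes "\<gamma> \<in> Nvec d" and "\<mu> \<in> S" "\<gamma> \<le> \<mu>" "\<And>\<beta>. \<beta> \<in> S \<Longrightarrow> \<gamma> \<le> \<beta> \<Longrightarrow> \<mu> \<le> \<beta>"
  shows "g \<mu> = g \<gamma>"
proof -
  have "\<mu> \<in> Nvec d" using assms(2) S_Nvec by blast
  then have "height d X \<mu> = height d X \<gamma>" if "X \<subseteq> S" "property_G2 d X" for X
    using height_least_above[OF that(2) assms(3)] assms(4) that(1) by blast
  then show ?thesis using E_S G2_S G2_E by (simp add: g_def)
qed

text \<open>The element found is \<open>\<ge> \<gamma>\<close> with \<open>i\<close>-th coordinate \<open>\<gamma> i\<close>, which no element of \<open>E\<close> achieves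
  because the step in \<open>E\<close> is ineffective.\<close>

lemma jump_element:
  assumes "\<gamma> \<in> Nvec d" and "i \<in> {1..d}" and "g (bump i \<gamma>) = g \<gamma> + 1"
  obtains \<mu> where "\<mu> \<in> S - E" "\<gamma> \<le> \<mu>" "g \<mu> = g \<gamma>" "\<And>\<beta>. \<beta> \<in> S \<Longrightarrow> \<gamma> \<le> \<beta> \<Longrightarrow> \<mu> \<le> \<beta>"
proof -
  obtain \<mu> where \<mu>: "\<mu> \<in> S" "\<gamma> \<le> \<mu>" "\<And>\<beta>. \<beta> \<in> S \<Longrightarrow> \<gamma> \<le> \<beta> \<Longrightarrow> \<mu> \<le> \<beta>"
    using least_above assms(1) by metis
  have st: "step S i \<gamma> = 1" "step E i \<gamma> = 0"
    using assms(3) g_bump[OF assms(1,2)] step_nonneg[of E i \<gamma>] step_le_1[of S i \<gamma>] by linarith+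
  obtain \<beta> where "\<beta> \<in> S" "\<gamma> \<le> \<beta>" "\<beta> i = \<gamma> i" using st(1) by (auto simp: step_def split: if_splits)
  then have "\<mu> i = \<gamma> i" using \<mu>(2,3) by (metis antisym le_fun_def)
  then have "\<mu> \<notin> E" using st(2) \<mu>(2) by (auto simp: step_def)
  then show ?thesis using that \<mu> g_least_above[OF assms(1)] by blast
qed

text \<open>If \<open>g\<close> rose in no direction, every step from \<alpha> would be effective
  for \<open>E\<close>; the least element of \<open>E\<close> above \<alpha> would then be \<alpha>
  itself.\<close>

lemma jump_direction:
  assumes "\<alpha> \<in> S - E"
  obtains i where "i \<in> {1..d}" "g (bump i \<alpha>) = g \<alpha> + 1"
proof -
  have "\<exists>i\<in>{1..d}. g (bump i \<alpha>) = g \<alpha> + 1"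
  proof (rule ccontr)
    assume none: "\<not> (\<exists>i\<in>{1..d}. g (bump i \<alpha>) = g \<alpha> + 1)"
    have \<alpha>: "\<alpha> \<in> Nvec d" using assms S_Nvec by blast
    obtain \<mu> where \<mu>: "\<mu> \<in> E" "\<alpha> \<le> \<mu>" "\<And>\<beta>. \<beta> \<in> E \<Longrightarrow> \<alpha> \<le> \<beta> \<Longrightarrow> \<mu> \<le> \<beta>"
      using least_above \<alpha> by metis
    have "\<mu> i = \<alpha> i" if i: "i \<in> {1..d}" for i
    proof -
      have "step S i \<alpha> = 1" using assms step_mem by blast
      then have "step E i \<alpha> \<noteq> 0" using g_bump[OF \<alpha> i] none i by auto
      then obtain \<beta> where "\<beta> \<in> E" "\<alpha> \<le> \<beta>" "\<beta> i = \<alpha> i" by (auto simp: step_def split: if_splits)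
      then show ?thesis using \<mu>(2,3) by (metis antisym le_fun_def)
    qed
    then have "\<mu> = \<alpha>" using \<mu>(1) E_S S_Nvec \<alpha> by (intro Nvec_eqI) auto
    then show False using assms \<mu>(1) by simp
  qed
  then show ?thesis using that by blast
qed

text \<open>The element \<open>sup \<gamma> c\<close> of \<open>E\<close> keeps coordinate i, so the
  step counts for both heights and cancels in \<open>g\<close>.\<close>

lemma g_full_step:
  assumes "\<gamma> \<in> Nvec d" and "i \<in> {1..d}" and "c i \<le> \<gamma> i"
  shows "step S i \<gamma> = 1" and "g (bump i \<gamma>) = g \<gamma>"
proof -
  have "sup \<gamma> c \<in> E" "\<gamma> \<le> sup \<gamma> c" "sup \<gamma> c i = \<gamma> i"
    using assms above_c Nvec_sup c_Nvec by (auto simp: sup_absorb1)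
  then have "\<exists>\<beta>\<in>E. \<gamma> \<le> \<beta> \<and> \<beta> i = \<gamma> i" by blast
  then have "step E i \<gamma> = 1" by (simp add: step_def)
  moreover from this show "step S i \<gamma> = 1"
    using step_mono[OF E_S, of i \<gamma>] step_le_1[of S i \<gamma>] by linarith
  ultimately show "g (bump i \<gamma>) = g \<gamma>" using g_bump[OF assms(1,2)] by simp
qed

lemma g_beyond_c:
  assumes "\<gamma> \<le> \<delta>" and "\<delta> \<in> Nvec d" and "\<And>i. i \<in> {1..d} \<Longrightarrow> \<gamma> i = \<delta> i \<or> c i \<le> \<gamma> i"
  shows "g \<delta> = g \<gamma>"
  using assms(1,2)
proof (induction rule: path_induct)
  case (step \<xi> i)
  have "\<gamma> i \<le> \<xi> i" using step(3) by (simp add: le_fun_def)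
  moreover have "\<xi> i < \<delta> i" using step(4) unfolding bump_le_iff by blast
  ultimately have "c i \<le> \<xi> i" using assms(3)[OF step(2)] by linarith
  then show ?case using g_full_step(2)[OF step(1,2)] step(5) by (simp del: fun_upd_apply)
qed simp

lemma g_le: "\<gamma> \<in> Nvec d \<Longrightarrow> g \<gamma> \<le> g c"
proof -
  assume \<gamma>: "\<gamma> \<in> Nvec d"
  have "g \<gamma> \<le> g (sup \<gamma> c)" using g_mono \<gamma> Nvec_sup c_Nvec by simp
  also have "\<dots> = g c" using g_beyond_c[of c "sup \<gamma> c"] \<gamma> Nvec_sup c_Nvec by simp
  finally show ?thesis .
qed

lemma g_less: "\<alpha> \<in> S - E \<Longrightarrow> g \<alpha> < g c"
  using jump_direction g_le Nvec_upd S_Nvec by (metis DiffD1 less_add_one order_less_le_trans subsetD)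

text \<open>The combinatorial content of a complete infimum: the strict-increase sets of the \<open>\<nu> i\<close>
  partition \<open>{1..d}\<close>.\<close>

lemma complete_infimumI:
  assumes \<alpha>: "\<alpha> \<in> S" and d: "d \<noteq> 0"
    and \<nu>: "\<And>i. i \<in> {1..d} \<Longrightarrow> \<nu> i \<in> Y \<and> \<nu> i \<in> S \<and> \<alpha> \<le> \<nu> i \<and> \<alpha> i < \<nu> i i"
    and part: "\<And>i l. i \<in> {1..d} \<Longrightarrow> l \<in> {1..d} \<Longrightarrow> \<alpha> l < \<nu> i l \<Longrightarrow> \<nu> l = \<nu> i"
    and not_below: "\<And>i. i \<in> {1..d} \<Longrightarrow> \<not> strictly_below d \<alpha> (\<nu> i)"
  shows "\<exists>r\<in>{2..d}. complete_infimum d S Y r \<alpha>"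
proof -
  define r where "r = card (\<nu> ` {1..d})"
  obtain f where f: "bij_betw f {1..r} (\<nu> ` {1..d})"
    using ex_bij_betw_nat_finite_1[of "\<nu> ` {1..d}"] unfolding r_def by auto
  define F where "F j = {i\<in>{1..d}. f j i = \<alpha> i}" for j
  have f_eq: "\<exists>i\<in>{1..d}. f j = \<nu> i" if "j \<in> {1..r}" for j
    using bij_betwE[OF f] that by blast
  have below: "\<alpha> \<le> f j" and fS: "f j \<in> S" and fY: "f j \<in> Y" if "j \<in> {1..r}" for j
    using f_eq[OF that] \<nu> by auto
  have r_le: "r \<le> d" unfolding r_def using card_image_le[of "{1..d}" \<nu>] by simp
  have r_ge: "2 \<le> r"
  proof (rule ccontr)
    assume "\<not> 2 \<le> r"
    moreover have "r \<noteq> 0" unfolding r_def using d by simp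
    ultimately have "card (\<nu> ` {1..d}) = 1" unfolding r_def by linarith
    then obtain v where v: "\<nu> ` {1..d} = {v}" using card_1_singletonE by blast
    then have "strictly_below d \<alpha> (\<nu> 1)" unfolding strictly_below_def
      using \<nu> d by (metis atLeastAtMost_iff empty_iff imageI insert_iff le_refl less_one not_le_imp_less linorder_not_le)
    then show False using not_below[of 1] d by simp
  qed
  have proper: "F j \<noteq> {} \<and> F j \<subset> {1..d} \<and> f j \<in> Delta d S (F j) \<alpha>" if j: "j \<in> {1..r}" for j
  proof -
    obtain i where i: "i \<in> {1..d}" "f j = \<nu> i" using f_eq[OF j] by blast
    have le: "\<alpha> k \<le> f j k" for k using below[OF j] by (simp add: le_fun_def)
    have "F j \<noteq> {}" using not_below[OF i(1)] i(2) le unfolding strictly_below_def F_def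
      by (metis (mono_tags, lifting) empty_iff mem_Collect_eq order_le_neq_trans)
    moreover have "i \<notin> F j" using \<nu>[OF i(1)] i(2) by (simp add: F_def)
    then have "F j \<subset> {1..d}" using i(1) unfolding F_def by blast
    moreover have "f j \<in> Delta d S (F j) \<alpha>"
      using fS[OF j] le unfolding Delta_def F_def by (auto simp: nat_less_le)
    ultimately show ?thesis by blast
  qed
  have disj: "inf (f j) (f k) = \<alpha>" if jk: "j \<in> {1..r}" "k \<in> {1..r}" "j \<noteq> k" for j k
  proof (rule Nvec_eqI[of _ d])
    show "inf (f j) (f k) \<in> Nvec d" using fS[OF jk(1)] S_Nvec Nvec_mono inf_le1 by blast
    show "\<alpha> \<in> Nvec d" using \<alpha> S_Nvec by blast
    fix l assume l: "l \<in> {1..d}"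
    obtain i i' where i: "i \<in> {1..d}" "f j = \<nu> i" "i' \<in> {1..d}" "f k = \<nu> i'" using f_eq jk by metis
    have "f j \<noteq> f k" using f jk unfolding bij_betw_def inj_on_def by blast
    then have "\<not> (\<alpha> l < f j l \<and> \<alpha> l < f k l)" using part[OF i(1) l] part[OF i(3) l] i by metis
    moreover have "\<alpha> l \<le> f j l" "\<alpha> l \<le> f k l" using below jk by (auto simp: le_fun_def)
    ultimately show "inf (f j) (f k) l = \<alpha> l" by (auto simp: inf_nat_def min_def)
  qed
  \<comment> \<open>A common index x would lie in the set belonging to \<open>\<nu> x\<close>, which
    exceeds \<alpha> at x.\<close>
  have "(\<Inter>j\<in>{1..r}. F j) = {}"
  proof (rule ccontr)
    assume "(\<Inter>j\<in>{1..r}. F j) \<noteq> {}"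
    then obtain x where x: "\<And>j. j \<in> {1..r} \<Longrightarrow> x \<in> F j" by blast
    then have xI: "x \<in> {1..d}" using r_ge by (force simp: F_def)
    then obtain j where "j \<in> {1..r}" "f j = \<nu> x" using f by (metis bij_betw_iff_bijections imageI)
    then show False using x[of j] \<nu>[OF xI] by (simp add: F_def)
  qed
  then have "complete_infimum d S Y r \<alpha>"
    unfolding complete_infimum_def using r_ge proper disj fY
    by (intro conjI exI[of _ f] exI[of _ F] ballI impI) simp_all
  then show ?thesis using r_ge r_le by auto
qed

text \<open>The minimal elements \<open>\<mu> i\<close> of \<open>S\<close> above \<open>bump i \<alpha>\<close> are covers of \<open>\<alpha>\<close>, so their
  strict-increase sets partition \<open>{1..d}\<close>. At most one of them lies in \<open>E\<close>, and it is replaced by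
  the element \<open>\<beta>\<close> of \<open>S - E\<close> above it at the next jump of \<open>g\<close>.\<close>

lemma below_or_complete_infimum:
  assumes \<alpha>: "\<alpha> \<in> S - E" and lt: "g \<alpha> + 1 < g c"
    and not_below: "\<And>\<beta>. \<beta> \<in> S - E \<Longrightarrow> g \<beta> \<le> g \<alpha> + 1 \<Longrightarrow> \<not> strictly_below d \<alpha> \<beta>"
    and Y: "\<And>\<beta>. \<beta> \<in> S - E \<Longrightarrow> \<alpha> \<le> \<beta> \<Longrightarrow> g \<beta> \<le> g \<alpha> + 1 \<Longrightarrow> \<beta> \<in> Y"
  shows "\<exists>r\<in>{2..d}. complete_infimum d S Y r \<alpha>"
proof -
  have \<alpha>N: "\<alpha> \<in> Nvec d" and \<alpha>S: "\<alpha> \<in> S" using \<alpha> S_Nvec by auto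
  obtain i0 where i0: "i0 \<in> {1..d}" "g (bump i0 \<alpha>) = g \<alpha> + 1" using jump_direction[OF \<alpha>] by blast
  have "\<exists>\<mu>\<in>S. bump i \<alpha> \<le> \<mu> \<and> (\<forall>\<beta>\<in>S. bump i \<alpha> \<le> \<beta> \<longrightarrow> \<mu> \<le> \<beta>)" if "i \<in> {1..d}" for i
    using least_above[OF _ Nvec_upd[OF \<alpha>N that]] by metis
  then obtain \<mu> where \<mu>: "\<And>i. i \<in> {1..d} \<Longrightarrow> \<mu> i \<in> S \<and> bump i \<alpha> \<le> \<mu> i"
    and \<mu>_min: "\<And>i \<beta>. i \<in> {1..d} \<Longrightarrow> \<beta> \<in> S \<Longrightarrow> bump i \<alpha> \<le> \<beta> \<Longrightarrow> \<mu> i \<le> \<beta>"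
    by metis
  have \<mu>_le: "\<alpha> \<le> \<mu> i" "\<alpha> i < \<mu> i i" if "i \<in> {1..d}" for i
    using \<mu>[OF that] by (auto simp: bump_le_iff)
  have height_\<mu>: "height d S (\<mu> i) = height d S \<alpha> + 1" if i: "i \<in> {1..d}" for i
    using height_least_above[OF G2_S, of "bump i \<alpha>" "\<mu> i"] \<mu>[OF i] \<mu>_min[OF i] S_Nvec
      height_bump[OF G2_S \<alpha>N i] step_mem[OF \<alpha>S, of i] by auto
  have g_\<mu>: "g (\<mu> i) = g (bump i \<alpha>)" if i: "i \<in> {1..d}" for i
    using g_least_above[OF Nvec_upd[OF \<alpha>N i]] \<mu>[OF i] \<mu>_min[OF i] by blast
  have g_\<mu>_le: "g (\<mu> i) \<le> g \<alpha> + 1" if i: "i \<in> {1..d}" for i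
    using g_\<mu>[OF i] g_bump_bounds(2)[OF \<alpha>N i] by simp
  \<comment> \<open>Both covers have height one more than \<alpha>, so comparable ones
    coincide.\<close>
  have \<mu>_part: "\<mu> l = \<mu> i" if il: "i \<in> {1..d}" "l \<in> {1..d}" "\<alpha> l < \<mu> i l" for i l
  proof (rule ccontr)
    assume ne: "\<mu> l \<noteq> \<mu> i"
    have "\<mu> l \<le> \<mu> i" using \<mu>_min[OF il(2)] \<mu>[OF il(1)] \<mu>_le(1)[OF il(1)] il(3) by (simp add: bump_le_iff)
    then have "height d S (\<mu> l) < height d S (\<mu> i)"
      using height_strict_mono[OF G2_S] ne \<mu> il S_Nvec by blast
    then show False using height_\<mu> il by simp
  qed
  have "\<exists>\<nu>. (\<forall>i\<in>{1..d}. \<nu> i \<in> S - E \<and> g (\<nu> i) \<le> g \<alpha> + 1 \<and> \<alpha> \<le> \<nu> i \<and> \<alpha> i < \<nu> i i) \<and>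
      (\<forall>i\<in>{1..d}. \<forall>l\<in>{1..d}. \<alpha> l < \<nu> i l \<longrightarrow> \<nu> l = \<nu> i)"
  proof (cases "\<exists>k\<in>{1..d}. \<mu> k \<in> E")
    case False
    then show ?thesis using \<mu> \<mu>_le g_\<mu>_le \<mu>_part by (intro exI[of _ \<mu>]) blast
  next
    case True
    then obtain k where k: "k \<in> {1..d}" "\<mu> k \<in> E" by blast
    have kN: "\<mu> k \<in> Nvec d" using k E_S S_Nvec by blast
    \<comment> \<open>Since \<open>g (\<mu> k) < g c\<close>, a jump at the value
      \<open>g (\<mu> k)\<close> occurs above \<open>\<mu> k\<close>; its element \<beta> stays
      within the bound on \<open>g\<close>.\<close>
    have "g (\<mu> k) < g (sup (\<mu> k) c)"
      using g_\<mu>_le[OF k(1)] lt g_beyond_c[of c "sup (\<mu> k) c"] kN Nvec_sup c_Nvec by auto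
    then obtain \<xi> j where \<xi>: "\<xi> \<in> Nvec d" "j \<in> {1..d}" "\<mu> k \<le> \<xi>" "g \<xi> = g (\<mu> k)" "g (bump j \<xi>) = g (\<mu> k) + 1"
      using g_crossing[OF sup_ge1 Nvec_sup[OF kN c_Nvec] order_refl] by metis
    then obtain \<beta> where \<beta>: "\<beta> \<in> S - E" "\<xi> \<le> \<beta>" "g \<beta> = g (\<mu> k)"
      using jump_element[of \<xi> j] by metis
    have k\<beta>: "\<mu> k \<le> \<beta>" using \<xi>(3) \<beta>(2) by simp
    have \<alpha>\<beta>: "\<alpha> \<le> \<beta>" using \<mu>_le(1)[OF k(1)] k\<beta> by simp
    \<comment> \<open>The element \<beta> replaces every cover whose block it meets, not only
      \<open>\<mu> k\<close>, so that the blocks still form a partition.\<close>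
    define \<nu> where "\<nu> i = (if \<alpha> i < \<beta> i then \<beta> else \<mu> i)" for i
    \<comment> \<open>A second cover in \<open>E\<close> has a block disjoint from that of
      \<open>\<mu> k\<close>, so (G1) for \<open>E\<close> would put \<alpha> in
      \<open>E\<close>.\<close>
    have E_block: "\<mu> i \<notin> E" if i: "i \<in> {1..d}" "\<not> \<alpha> i < \<beta> i" for i
    proof
      assume E: "\<mu> i \<in> E"
      have "inf (\<mu> i) (\<mu> k) = \<alpha>"
      proof (rule Nvec_eqI[OF _ \<alpha>N])
        show "inf (\<mu> i) (\<mu> k) \<in> Nvec d" using kN Nvec_mono inf_le2 by blast
        fix l assume l: "l \<in> {1..d}"
        have "\<not> (\<alpha> l < \<mu> i l \<and> \<alpha> l < \<mu> k l)"
        proof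
          assume "\<alpha> l < \<mu> i l \<and> \<alpha> l < \<mu> k l"
          then have "\<mu> i = \<mu> k" using \<mu>_part[OF i(1) l] \<mu>_part[OF k(1) l] by simp
          then have "\<alpha> i < \<mu> k i" using \<mu>_le(2)[OF i(1)] by simp
          then show False using i(2) k\<beta> by (metis le_fun_def order_less_le_trans)
        qed
        moreover have "\<alpha> l \<le> \<mu> i l" "\<alpha> l \<le> \<mu> k l" using \<mu>_le i k by (auto simp: le_fun_def)
        ultimately show "inf (\<mu> i) (\<mu> k) l = \<alpha> l" by (auto simp: inf_nat_def min_def)
      qed
      then show False using \<alpha> E k(2) G1_E unfolding property_G1_def by (metis DiffD2)
    qed
    have "\<nu> l = \<nu> i" if il: "i \<in> {1..d}" "l \<in> {1..d}" "\<alpha> l < \<nu> i l" for i l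
    proof (cases "\<alpha> i < \<beta> i")
      case True
      then show ?thesis using il by (simp add: \<nu>_def)
    next
      case False
      then have il': "\<alpha> l < \<mu> i l" using il by (simp add: \<nu>_def)
      \<comment> \<open>Exceeding \<alpha> at l puts \<beta> above the cover
        \<open>\<mu> l = \<mu> i\<close>, hence above \<alpha> at i.\<close>
      have "\<not> \<alpha> l < \<beta> l"
      proof
        assume "\<alpha> l < \<beta> l"
        then have "\<mu> l \<le> \<beta>" using \<mu>_min[OF il(2)] \<beta>(1) \<alpha>\<beta> by (simp add: bump_le_iff)
        then have "\<mu> i \<le> \<beta>" using \<mu>_part[OF il(1,2) il'] by simp
        then show False using \<mu>_le(2)[OF il(1)] False by (metis le_fun_def order_less_le_trans)
      qed
      then show ?thesis using False \<mu>_part[OF il(1,2) il'] by (simp add: \<nu>_def)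
    qed
    moreover have "\<nu> i \<in> S - E \<and> g (\<nu> i) \<le> g \<alpha> + 1 \<and> \<alpha> \<le> \<nu> i \<and> \<alpha> i < \<nu> i i" if i: "i \<in> {1..d}" for i
      using \<beta> \<alpha>\<beta> g_\<mu>_le[OF k(1)] g_\<mu>_le[OF i] \<mu>[OF i] \<mu>_le[OF i] E_block[OF i] by (auto simp: \<nu>_def)
    ultimately show ?thesis by blast
  qed
  then obtain \<nu> where \<nu>: "\<And>i. i \<in> {1..d} \<Longrightarrow> \<nu> i \<in> S - E \<and> g (\<nu> i) \<le> g \<alpha> + 1 \<and> \<alpha> \<le> \<nu> i \<and> \<alpha> i < \<nu> i i"
    and part: "\<And>i l. i \<in> {1..d} \<Longrightarrow> l \<in> {1..d} \<Longrightarrow> \<alpha> l < \<nu> i l \<Longrightarrow> \<nu> l = \<nu> i"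
    by blast
  show ?thesis
  proof (rule complete_infimumI[OF \<alpha>S, of \<nu>])
    show "d \<noteq> 0" using i0 by auto
    show "\<nu> i \<in> Y \<and> \<nu> i \<in> S \<and> \<alpha> \<le> \<nu> i \<and> \<alpha> i < \<nu> i i" if "i \<in> {1..d}" for i
      using \<nu>[OF that] Y by blast
    show "\<not> strictly_below d \<alpha> (\<nu> i)" if "i \<in> {1..d}" for i
      using \<nu>[OF that] not_below by blast
  qed (rule part)
qed

section \<open>Levels as level sets of \<open>g\<close>\<close>

text \<open>Any \<beta> strictly above \<alpha> lies above the step from \<alpha> at which
  \<open>g\<close> jumps.\<close>

lemma g_less_if_strictly_below:
  assumes "\<alpha> \<in> S - E" and "\<beta> \<in> S" and "strictly_below d \<alpha> \<beta>"
  shows "g \<alpha> < g \<beta>"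
proof -
  obtain i where i: "i \<in> {1..d}" "g (bump i \<alpha>) = g \<alpha> + 1" using jump_direction[OF assms(1)] by blast
  have "\<alpha> \<le> \<beta>" using assms S_Nvec by (intro Nvec_leI) (auto simp: strictly_below_def less_imp_le)
  then have "bump i \<alpha> \<le> \<beta>" using assms(3) i(1) by (simp add: bump_le_iff strictly_below_def)
  then have "g (bump i \<alpha>) \<le> g \<beta>" using g_mono assms(2) S_Nvec by blast
  then show ?thesis using i(2) by simp
qed

text \<open>The sets \<open>F j\<close> have empty intersection, so one constituent moves in the
  direction in which \<open>g\<close> jumps.\<close>

lemma g_less_if_complete_infimum:
  assumes \<alpha>: "\<alpha> \<in> S - E" and "complete_infimum d S Y r \<alpha>"
  shows "\<exists>\<beta>\<in>Y. g \<alpha> < g \<beta>"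
proof -
  obtain \<beta> F where r: "r \<ge> 2"
    and F: "\<forall>j\<in>{1..r}. \<beta> j \<in> Y \<and> F j \<noteq> {} \<and> F j \<subset> {1..d} \<and> \<beta> j \<in> Delta d S (F j) \<alpha>"
    and int: "(\<Inter>j\<in>{1..r}. F j) = {}"
    using assms(2) unfolding complete_infimum_def by blast
  obtain i where i: "i \<in> {1..d}" "g (bump i \<alpha>) = g \<alpha> + 1" using jump_direction[OF \<alpha>] by blast
  obtain j where j: "j \<in> {1..r}" "i \<notin> F j" using int by blast
  have \<beta>: "\<beta> j \<in> S" "\<And>k. k \<in> F j \<Longrightarrow> \<beta> j k = \<alpha> k" "\<And>k. k \<in> {1..d} - F j \<Longrightarrow> \<alpha> k < \<beta> j k"
    using F j(1) by (auto simp: Delta_def)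
  have "\<alpha> \<le> \<beta> j"
  proof (rule Nvec_leI[of _ d])
    show "\<alpha> \<in> Nvec d" using \<alpha> S_Nvec by blast
    show "\<alpha> k \<le> \<beta> j k" if "k \<in> {1..d}" for k
      using \<beta>(2,3)[of k] that by (cases "k \<in> F j") auto
  qed
  then have "bump i \<alpha> \<le> \<beta> j" using \<beta>(3)[of i] i(1) j(2) by (simp add: bump_le_iff)
  then have "g (bump i \<alpha>) \<le> g (\<beta> j)" using g_mono \<beta>(1) S_Nvec by blast
  then have "g \<alpha> < g (\<beta> j)" using i(2) by linarith
  then show ?thesis using F j(1) by blast
qed

text \<open>The parts removed earlier carry the values above \<open>g c - i\<close>. Elements of
  value \<open>g c - i\<close> survive because \<open>g\<close> is maximal there on what remains;
  those of smaller value fail \<open>B_part\<close> or fall into \<open>C_part\<close> by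
  \<open>below_or_complete_infimum\<close>.\<close>

lemma D_part_eq: "i \<ge> 1 \<Longrightarrow> D_part d S E i = {\<alpha>\<in>S - E. g \<alpha> = g c - int i}"
proof (induction i rule: less_induct)
  case (less i)
  define R where "R = (S - E) - (\<Union>j\<in>{1..<i}. D_part d S E j)"
  have R: "R = {\<alpha>\<in>S - E. g \<alpha> \<le> g c - int i}"
  proof -
    have "(\<Union>j\<in>{1..<i}. D_part d S E j) = {\<alpha>\<in>S - E. g \<alpha> > g c - int i}"
    proof (intro set_eqI iffI)
      fix \<alpha> assume a: "\<alpha> \<in> {\<alpha>\<in>S - E. g \<alpha> > g c - int i}"
      define j where "j = nat (g c - g \<alpha>)"
      have "j \<in> {1..<i}" "g \<alpha> = g c - int j" using a g_less[of \<alpha>] by (auto simp: j_def)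
      then show "\<alpha> \<in> (\<Union>j\<in>{1..<i}. D_part d S E j)" using less.IH[of j] a by auto
    qed (use less.IH in auto)
    then show ?thesis unfolding R_def by auto
  qed
  have "\<alpha> \<in> B_part d R - C_part d S R \<longleftrightarrow> \<alpha> \<in> S - E \<and> g \<alpha> = g c - int i" for \<alpha>
  proof
    assume a: "\<alpha> \<in> S - E \<and> g \<alpha> = g c - int i"
    then have "\<alpha> \<in> B_part d R"
      unfolding B_part_def R using g_less_if_strictly_below[of \<alpha>] by fastforce
    moreover have "\<alpha> \<notin> C_part d S R"
      unfolding C_part_def using g_less_if_complete_infimum[of \<alpha>] a by (fastforce simp: B_part_def R)
    ultimately show "\<alpha> \<in> B_part d R - C_part d S R" by blast
  next
    assume a: "\<alpha> \<in> B_part d R - C_part d S R"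
    then have \<alpha>: "\<alpha> \<in> S - E" "g \<alpha> \<le> g c - int i" and top: "\<And>\<beta>. \<beta> \<in> R \<Longrightarrow> \<not> strictly_below d \<alpha> \<beta>"
      by (auto simp: B_part_def R)
    have "g \<alpha> = g c - int i"
    proof (rule ccontr)
      assume "g \<alpha> \<noteq> g c - int i"
      then have lt: "g \<alpha> + 1 \<le> g c - int i" using \<alpha>(2) by simp
      have inR: "\<beta> \<in> R" if "\<beta> \<in> S - E" "g \<beta> \<le> g \<alpha> + 1" for \<beta>
        using that lt by (auto simp: R)
      \<comment> \<open>Elements above \<alpha> inherit from it that nothing in \<open>R\<close> is
        strictly above them.\<close>
      have "\<beta> \<in> B_part d R" if \<beta>: "\<beta> \<in> S - E" "\<alpha> \<le> \<beta>" "g \<beta> \<le> g \<alpha> + 1" for \<beta>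
      proof -
        have "\<not> strictly_below d \<beta> \<gamma>" if "\<gamma> \<in> R" for \<gamma>
          using top[OF that] \<beta>(2) unfolding strictly_below_def le_fun_def by (meson le_less_trans)
        then show ?thesis using inR \<beta> by (auto simp: B_part_def)
      qed
      then have "\<exists>r\<in>{2..d}. complete_infimum d S (B_part d R) r \<alpha>"
        using below_or_complete_infimum[OF \<alpha>(1)] lt less.prems top inR by fastforce
      then show False using a by (auto simp: C_part_def)
    qed
    then show "\<alpha> \<in> S - E \<and> g \<alpha> = g c - int i" using \<alpha>(1) by blast
  qed
  then have "B_part d R - C_part d S R = {\<alpha>\<in>S - E. g \<alpha> = g c - int i}" by blast
  then show ?case by (subst D_part.simps) (simp add: Let_def R_def)
qed

lemma level_value_nonempty:
  assumes "0 \<le> t" and "t < g c"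
  shows "\<exists>\<alpha>\<in>S - E. g \<alpha> = t"
proof -
  have le: "(\<lambda>_. 0) \<le> c" by (simp add: le_fun_def)
  have "g (\<lambda>_. 0) \<le> t" using assms(1) by (simp add: g_def height_def)
  then obtain \<xi> i where "\<xi> \<in> Nvec d" "i \<in> {1..d}" "g \<xi> = t" "g (bump i \<xi>) = t + 1"
    using g_crossing[OF le c_Nvec _ assms(2)] by metis
  then show ?thesis using jump_element by metis
qed

text \<open>\<open>THE\<close> needs uniqueness of the count: a nonempty last part forces
  \<open>M \<le> g c\<close>, and an element of value 0 forces \<open>g c \<le> M\<close>.\<close>

lemma num_levels_eq: "int (num_levels d S E) = g c"
proof -
  have g0: "0 \<le> g c" using g_nonneg c_Nvec .
  have "num_levels d S E = nat (g c)"
    unfolding num_levels_def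
  proof (rule the_equality, intro conjI ballI)
    show "S - E = (\<Union>i\<in>{1..nat (g c)}. D_part d S E i)"
    proof (intro set_eqI iffI)
      fix \<alpha> assume \<alpha>: "\<alpha> \<in> S - E"
      define j where "j = nat (g c - g \<alpha>)"
      have "j \<in> {1..nat (g c)}" "g \<alpha> = g c - int j"
        using \<alpha> g_less[of \<alpha>] g_nonneg[of \<alpha>] S_Nvec by (auto simp: j_def)
      then show "\<alpha> \<in> (\<Union>i\<in>{1..nat (g c)}. D_part d S E i)" using D_part_eq[of j] \<alpha> by auto
    qed (auto simp: D_part_eq)
    show "D_part d S E i \<noteq> {}" if i: "i \<in> {1..nat (g c)}" for i
    proof -
      have "0 \<le> g c - int i" "g c - int i < g c" using i g0 by auto
      then obtain \<alpha> where "\<alpha> \<in> S - E" "g \<alpha> = g c - int i" using level_value_nonempty by blast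
      then have "\<alpha> \<in> D_part d S E i" using D_part_eq[of i] i by simp
      then show ?thesis by blast
    qed
  next
    fix M assume M: "S - E = (\<Union>i\<in>{1..M}. D_part d S E i) \<and> (\<forall>i\<in>{1..M}. D_part d S E i \<noteq> {})"
    have "int M \<le> g c"
    proof (cases "M = 0")
      case False
      then have "D_part d S E M \<noteq> {}" using M by simp
      then obtain \<alpha> where "\<alpha> \<in> S - E" "g \<alpha> = g c - int M" using D_part_eq[of M] False by auto
      then show ?thesis using g_nonneg[of \<alpha>] S_Nvec by auto
    qed (use g0 in simp)
    moreover have "g c \<le> int M"
    proof (rule ccontr)
      assume n: "\<not> g c \<le> int M"
      then obtain \<alpha> where \<alpha>: "\<alpha> \<in> S - E" "g \<alpha> = 0" using level_value_nonempty[of 0] by auto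
      then obtain i where "i \<in> {1..M}" "\<alpha> \<in> D_part d S E i" using M by blast
      then show False using D_part_eq[of i] \<alpha> n by auto
    qed
    ultimately show "M = nat (g c)" by simp
  qed
  then show ?thesis using g0 by simp
qed

text \<open>With \<open>N = g c\<close>, reversing the index turns \<open>g c - (N + 1 - i)\<close>
  into \<open>i - 1\<close>.\<close>

lemma level_eq:
  assumes "i \<in> {1..num_levels d S E}"
  shows "level d S E i = {\<alpha>\<in>S - E. g \<alpha> = int i - 1}"
  using assms num_levels_eq by (auto simp: level_def D_part_eq)

section \<open>Subspaces inside levels\<close>

text \<open>(G2) applied to \<xi> and an element agreeing with it only at j raises coordinate j and
  fixes the rest; an infimum then cuts the rise down to one step.\<close>

lemma bump_mem:
  assumes "\<xi> \<in> S" and j: "j \<in> {1..d}" and "c j \<le> \<xi> j"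
  shows "bump j \<xi> \<in> S"
proof -
  have \<xi>: "\<xi> \<in> Nvec d" using assms(1) S_Nvec by blast
  define z where "z m = (\<lambda>i. if i = j then m else if i \<in> {1..d} then max (Suc (\<xi> i)) (c i) else 0)"
    for m
  define x where "x = z (\<xi> j)"
  define y where "y = z (Suc (\<xi> j))"
  have z: "z m \<in> S" if "c j \<le> m" for m
  proof -
    have "z m \<in> Nvec d" using j by (auto simp: z_def Nvec_def)
    moreover have "c \<le> z m" by (rule Nvec_leI[OF c_Nvec]) (use that in \<open>auto simp: z_def\<close>)
    ultimately show ?thesis using above_c E_S by blast
  qed
  have xy: "x \<in> S" "y \<in> S" using z assms(3) by (auto simp: x_def y_def)
  show ?thesis
  proof (cases "x = \<xi>")
    \<comment> \<open>Here d = 1, as \<open>x\<close> exceeds \<xi> away from j; (G2) needs distinct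
      elements.\<close>
    case True
    moreover have "y = x(j := Suc (\<xi> j))" by (auto simp: x_def y_def z_def)
    ultimately have "y = bump j \<xi>" by simp
    then show ?thesis using xy by simp
  next
    case False
    have "x j = \<xi> j" by (simp add: x_def z_def)
    then obtain \<epsilon> where \<epsilon>: "\<epsilon> \<in> S" "\<epsilon> j > \<xi> j"
      "\<And>k. k \<in> {1..d} - {j} \<Longrightarrow> \<xi> k \<noteq> x k \<longrightarrow> \<epsilon> k = min (\<xi> k) (x k)"
      using G2_S assms(1) xy(1) False j unfolding property_G2_def by metis
    have "inf \<epsilon> y = bump j \<xi>"
    proof (rule Nvec_eqI[of _ d])
      show "inf \<epsilon> y \<in> Nvec d" using xy(2) S_Nvec Nvec_mono inf_le2 by blast
      show "bump j \<xi> \<in> Nvec d" using Nvec_upd \<xi> j by blast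
      show "inf \<epsilon> y k = bump j \<xi> k" if k: "k \<in> {1..d}" for k
      proof (cases "k = j")
        case True
        then show ?thesis using \<epsilon>(2) by (simp add: y_def z_def inf_nat_def)
      next
        case False
        then have "x k > \<xi> k" "y k > \<xi> k" using k by (auto simp: x_def y_def z_def)
        moreover from this have "\<epsilon> k = \<xi> k" using \<epsilon>(3)[of k] k False by simp
        ultimately show ?thesis using False by (simp add: inf_nat_def)
      qed
    qed
    then show ?thesis using G1_S \<epsilon>(1) xy(2) unfolding property_G1_def by metis
  qed
qed

lemma mem_beyond_c:
  assumes "\<gamma> \<le> \<delta>" and "\<delta> \<in> Nvec d" and "\<gamma> \<in> S" and "\<And>i. i \<in> {1..d} \<Longrightarrow> \<gamma> i = \<delta> i \<or> c i \<le> \<gamma> i"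
  shows "\<delta> \<in> S"
  using assms(1,2)
proof (induction rule: path_induct)
  case base
  show ?case by fact
next
  case (step \<xi> i)
  have "\<gamma> i \<le> \<xi> i" using step(3) by (simp add: le_fun_def)
  moreover have "\<xi> i < \<delta> i" using step(4) unfolding bump_le_iff by blast
  ultimately have "c i \<le> \<xi> i" using assms(4)[OF step(2)] by linarith
  then show ?case using bump_mem[OF step(5,2)] by blast
qed

definition corner :: "nat set \<Rightarrow> nat \<Rightarrow> nat" where
  "corner U = (\<lambda>i. if i \<in> U then 0 else c i)"

lemma corner_Nvec: "corner U \<in> Nvec d"
  using c_Nvec by (auto simp: corner_def Nvec_def)

text \<open>A jump on the path from \<open>corner U\<close> to \<open>c\<close> starts at a point
  equal to \<open>c\<close> off \<open>U\<close>, and the same holds for its element \<mu>. Raising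
  coordinates already beyond \<open>c\<close> changes neither membership in \<open>S\<close> nor
  \<open>g\<close>.\<close>

lemma subspace_at_value:
  assumes U: "U \<subseteq> {1..d}" and t: "g (corner U) \<le> t" "t < g c"
  obtains \<alpha> where "\<alpha> \<in> Nvec d" "\<And>j. j \<in> {1..d} - U \<Longrightarrow> \<alpha> j = c j"
    "\<And>\<beta>. \<beta> \<in> Nvec d \<Longrightarrow> (\<And>i. i \<in> U \<Longrightarrow> \<beta> i = \<alpha> i) \<Longrightarrow> (\<And>j. j \<in> {1..d} - U \<Longrightarrow> c j \<le> \<beta> j) \<Longrightarrow>
      \<beta> \<in> S - E \<and> g \<beta> = t"
proof -
  have "corner U \<le> c" by (simp add: corner_def le_fun_def)
  then obtain \<xi> m where \<xi>: "\<xi> \<in> Nvec d" "m \<in> {1..d}" "corner U \<le> \<xi>" "bump m \<xi> \<le> c"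
      "g \<xi> = t" "g (bump m \<xi>) = t + 1"
    using g_crossing[OF _ c_Nvec t] by metis
  then obtain \<mu> where \<mu>: "\<mu> \<in> S - E" "\<xi> \<le> \<mu>" "g \<mu> = t" "\<And>\<beta>. \<beta> \<in> S \<Longrightarrow> \<xi> \<le> \<beta> \<Longrightarrow> \<mu> \<le> \<beta>"
    using jump_element[of \<xi> m] by metis
  have \<mu>N: "\<mu> \<in> Nvec d" using \<mu>(1) S_Nvec by blast
  have \<xi>c: "\<xi> \<le> c" using \<xi>(4) unfolding bump_le_iff by blast
  have \<xi>_off: "\<xi> j = c j" if "j \<notin> U" for j
    using that le_funD[OF \<xi>(3), of j] le_funD[OF \<xi>c, of j] by (simp add: corner_def)
  \<comment> \<open>A point of \<open>E\<close> equal to \<open>c\<close> off \<open>U\<close> and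
    at least \<mu> on \<open>U\<close>: it bounds \<mu> off \<open>U\<close>, and its infimum with
    \<beta> recovers \<mu>.\<close>
  define x where "x = (\<lambda>i. if i \<in> U then max (\<mu> i) (c i) else c i)"
  have x: "x \<in> E"
    using \<mu>N c_Nvec U by (intro above_c) (auto simp: x_def Nvec_def le_fun_def)
  have \<mu>_off: "\<mu> j = c j" if j: "j \<notin> U" for j
  proof -
    have "\<xi> \<le> x" using \<xi>c by (auto simp: x_def le_fun_def le_max_iff_disj)
    moreover have "x \<in> S" using x E_S by blast
    ultimately have "\<mu> j \<le> x j" using \<mu>(4) by (simp add: le_fun_def)
    moreover have "c j \<le> \<mu> j" using \<xi>_off[OF j] le_funD[OF \<mu>(2), of j] by simp
    ultimately show ?thesis using j by (simp add: x_def)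
  qed
  have "\<beta> \<in> S - E \<and> g \<beta> = t"
    if \<beta>: "\<beta> \<in> Nvec d" "\<And>i. i \<in> U \<Longrightarrow> \<beta> i = \<mu> i" "\<And>j. j \<in> {1..d} - U \<Longrightarrow> c j \<le> \<beta> j" for \<beta>
  proof -
    have le: "\<mu> \<le> \<beta>"
    proof (rule Nvec_leI[OF \<mu>N])
      show "\<mu> i \<le> \<beta> i" if "i \<in> {1..d}" for i
        using \<beta>(2,3)[of i] \<mu>_off[of i] that by (cases "i \<in> U") auto
    qed
    have split: "\<mu> i = \<beta> i \<or> c i \<le> \<mu> i" for i
      using \<beta>(2)[of i] \<mu>_off[of i] by (cases "i \<in> U") auto
    have "\<beta> \<notin> E"
    proof
      assume "\<beta> \<in> E"
      then have "inf \<beta> x \<in> E" using x G1_E unfolding property_G1_def by blast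
      moreover have "inf \<beta> x = \<mu>"
      proof (rule Nvec_eqI[OF _ \<mu>N])
        show "inf \<beta> x \<in> Nvec d" using \<beta>(1) Nvec_mono inf_le1 by blast
        show "inf \<beta> x i = \<mu> i" if "i \<in> {1..d}" for i
          using \<beta>(2,3)[of i] \<mu>_off[of i] that by (cases "i \<in> U") (auto simp: x_def inf_nat_def)
      qed
      ultimately show False using \<mu>(1) by simp
    qed
    then show ?thesis
      using mem_beyond_c[OF le \<beta>(1)] g_beyond_c[OF le \<beta>(1)] split \<mu>(1,3) by auto
  qed
  then show ?thesis using that[of \<mu>] \<mu>N \<mu>_off by blast
qed

lemma contains_subspace_level_iff:
  assumes c: "c = conductor d E" and i: "i \<in> {1..num_levels d S E}"
  shows "contains_subspace d E (level d S E i) n \<longleftrightarrow>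
    (\<exists>U. U \<noteq> {} \<and> U \<subseteq> {1..d} \<and> n = d - card U \<and> g (corner U) \<le> int i - 1)"
proof
  assume "contains_subspace d E (level d S E i) n"
  then obtain U \<alpha> where U: "U \<noteq> {}" "U \<subseteq> {1..d}" "n = d - card U"
    and \<alpha>: "\<alpha> \<in> Nvec d" "\<forall>j\<in>{1..d} - U. \<alpha> j = c j" and sub: "U_subspace d U \<alpha> \<subseteq> level d S E i"
    unfolding contains_subspace_def c by blast
  \<comment> \<open>For \<open>U \<noteq> {1..d}\<close> the base point is excluded from the
    subspace, so a neighbour of it is taken.\<close>
  obtain \<beta> where \<beta>: "\<beta> \<in> U_subspace d U \<alpha>" "\<alpha> \<le> \<beta>"
  proof (cases "U = {1..d}")
    case True
    then show ?thesis using that[of \<alpha>] by (simp add: U_subspace_def)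
  next
    case False
    then obtain j where j: "j \<in> {1..d}" "j \<notin> U" using U(2) by blast
    have "bump j \<alpha> \<in> Delta_tilde d (Nvec d) U \<alpha>"
      unfolding Delta_tilde_def using Nvec_upd[OF \<alpha>(1) j(1)] j by (auto simp: fun_eq_iff)
    then show ?thesis using that[of "bump j \<alpha>"] False le_bump by (simp add: U_subspace_def)
  qed
  have \<beta>l: "\<beta> \<in> S" "g \<beta> = int i - 1" using \<beta>(1) sub level_eq[OF i] by auto
  have "corner U \<le> \<alpha>"
    by (rule Nvec_leI[OF corner_Nvec]) (use \<alpha>(2) in \<open>auto simp: corner_def\<close>)
  then have "g (corner U) \<le> int i - 1" using g_mono[of "corner U" \<beta>] \<beta>(2) \<beta>l S_Nvec by auto
  then show "\<exists>U. U \<noteq> {} \<and> U \<subseteq> {1..d} \<and> n = d - card U \<and> g (corner U) \<le> int i - 1" using U by blast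
next
  assume "\<exists>U. U \<noteq> {} \<and> U \<subseteq> {1..d} \<and> n = d - card U \<and> g (corner U) \<le> int i - 1"
  then obtain U where U: "U \<noteq> {}" "U \<subseteq> {1..d}" "n = d - card U" and t: "g (corner U) \<le> int i - 1"
    by blast
  have "int i - 1 < g c" using i num_levels_eq by auto
  then obtain \<alpha> where \<alpha>: "\<alpha> \<in> Nvec d" "\<And>j. j \<in> {1..d} - U \<Longrightarrow> \<alpha> j = c j"
    and all: "\<And>\<beta>. \<beta> \<in> Nvec d \<Longrightarrow> (\<And>i. i \<in> U \<Longrightarrow> \<beta> i = \<alpha> i) \<Longrightarrow>
      (\<And>j. j \<in> {1..d} - U \<Longrightarrow> c j \<le> \<beta> j) \<Longrightarrow> \<beta> \<in> S - E \<and> g \<beta> = int i - 1"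
    using subspace_at_value[OF U(2) t] by metis
  have "\<beta> \<in> level d S E i" if \<beta>: "\<beta> \<in> U_subspace d U \<alpha>" for \<beta>
  proof -
    have "\<beta> \<in> Nvec d \<and> (\<forall>i\<in>U. \<beta> i = \<alpha> i) \<and> (\<forall>j\<in>{1..d} - U. \<alpha> j \<le> \<beta> j)"
      using \<beta> \<alpha>(1) by (auto simp: U_subspace_def Delta_tilde_def split: if_splits)
    then have "\<beta> \<in> S - E \<and> g \<beta> = int i - 1" using all[of \<beta>] \<alpha>(2) by simp
    then show ?thesis using level_eq[OF i] by simp
  qed
  then show "contains_subspace d E (level d S E i) n"
    unfolding contains_subspace_def using U \<alpha> c by blast
qed

end

section \<open>Principal ideals\<close>

lemma translate_mem_iff:
  assumes "\<omega> \<in> Nvec d" and "X \<subseteq> Nvec d"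
  shows "\<alpha> \<in> \<omega> +o X \<longleftrightarrow> \<omega> \<le> \<alpha> \<and> (\<lambda>i. \<alpha> i - \<omega> i) \<in> X"
proof
  assume "\<alpha> \<in> \<omega> +o X"
  then obtain \<beta> where "\<beta> \<in> X" "\<alpha> = \<omega> + \<beta>" by (auto simp: elt_set_plus_def)
  then show "\<omega> \<le> \<alpha> \<and> (\<lambda>i. \<alpha> i - \<omega> i) \<in> X" by (simp add: le_fun_def)
next
  assume h: "\<omega> \<le> \<alpha> \<and> (\<lambda>i. \<alpha> i - \<omega> i) \<in> X"
  then have "\<alpha> = \<omega> + (\<lambda>i. \<alpha> i - \<omega> i)" by (auto simp: le_fun_def fun_eq_iff)
  then show "\<alpha> \<in> \<omega> +o X" using h by (metis set_plus_intro2)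
qed

lemma translate_Nvec_subset_iff:
  assumes "\<alpha> \<in> Nvec d"
  shows "\<alpha> +o Nvec d \<subseteq> E \<longleftrightarrow> (\<forall>\<gamma>\<in>Nvec d. \<alpha> \<le> \<gamma> \<longrightarrow> \<gamma> \<in> E)"
proof -
  have "\<gamma> \<in> \<alpha> +o Nvec d \<longleftrightarrow> \<gamma> \<in> Nvec d \<and> \<alpha> \<le> \<gamma>" for \<gamma>
    using translate_mem_iff[OF assms order_refl, of \<gamma>] assms
    by (auto simp: Nvec_def)
  then show ?thesis by blast
qed

text \<open>By distributivity, \<gamma> above \<open>inf \<alpha> \<beta>\<close> is the infimum of
  \<open>sup \<gamma> \<alpha>\<close> and \<open>sup \<gamma> \<beta>\<close>; with (G1) the
  candidates are closed under infimum, so \<open>LEAST\<close> yields a genuine minimum.\<close>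

lemma conductor_props:
  assumes E: "property_G1 E" and "c0 \<in> Nvec d" and "c0 +o Nvec d \<subseteq> E"
  shows "conductor d E \<in> Nvec d" and "\<And>\<gamma>. \<gamma> \<in> Nvec d \<Longrightarrow> conductor d E \<le> \<gamma> \<Longrightarrow> \<gamma> \<in> E"
proof -
  define Y where "Y = {\<alpha> \<in> Nvec d. \<forall>\<gamma>\<in>Nvec d. \<alpha> \<le> \<gamma> \<longrightarrow> \<gamma> \<in> E}"
  have Y: "\<alpha> \<in> Y \<longleftrightarrow> \<alpha> \<in> Nvec d \<and> \<alpha> +o Nvec d \<subseteq> E" for \<alpha>
    using translate_Nvec_subset_iff by (auto simp: Y_def)
  have "inf \<alpha> \<beta> \<in> Y" if ab: "\<alpha> \<in> Y" "\<beta> \<in> Y" for \<alpha> \<beta>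
  proof -
    have N: "\<alpha> \<in> Nvec d" "\<beta> \<in> Nvec d" using ab by (auto simp: Y_def)
    have "\<gamma> \<in> E" if \<gamma>: "\<gamma> \<in> Nvec d" "inf \<alpha> \<beta> \<le> \<gamma>" for \<gamma>
    proof -
      have "sup \<gamma> \<alpha> \<in> E" "sup \<gamma> \<beta> \<in> E" using ab N Nvec_sup[OF \<gamma>(1)] by (auto simp: Y_def)
      then have "inf (sup \<gamma> \<alpha>) (sup \<gamma> \<beta>) \<in> E" using E unfolding property_G1_def by blast
      moreover have "inf (sup \<gamma> \<alpha>) (sup \<gamma> \<beta>) = \<gamma>"
        using \<gamma>(2) by (simp add: sup_inf_distrib1[symmetric] sup_absorb1)
      ultimately show ?thesis by simp
    qed
    moreover have "inf \<alpha> \<beta> \<in> Nvec d" using N Nvec_mono inf_le1 by blast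
    ultimately show ?thesis by (simp add: Y_def)
  qed
  moreover have "c0 \<in> Y" using assms Y by blast
  moreover have "Y \<subseteq> Nvec d" by (auto simp: Y_def)
  ultimately obtain \<mu> where \<mu>: "\<mu> \<in> Y" "\<And>\<beta>. \<beta> \<in> Y \<Longrightarrow> \<mu> \<le> \<beta>"
    using inf_closed_has_least[of Y d] by blast
  have "conductor d E = \<mu>"
    unfolding conductor_def
  proof (rule Least_equality)
    show "\<mu> \<in> Nvec d \<and> \<mu> +o Nvec d \<subseteq> E" using \<mu>(1) Y by blast
    show "\<mu> \<le> \<alpha>" if "\<alpha> \<in> Nvec d \<and> \<alpha> +o Nvec d \<subseteq> E" for \<alpha> using \<mu>(2) Y that by blast
  qed
  then have "conductor d E \<in> Y" using \<mu>(1) by simp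
  then show "conductor d E \<in> Nvec d" "\<And>\<gamma>. \<gamma> \<in> Nvec d \<Longrightarrow> conductor d E \<le> \<gamma> \<Longrightarrow> \<gamma> \<in> E"
    unfolding Y_def by blast+
qed

lemma G1_translate: "property_G1 X \<Longrightarrow> property_G1 (\<omega> +o X)"
proof -
  assume X: "property_G1 X"
  have "inf (\<omega> + \<alpha>) (\<omega> + \<beta>) = \<omega> + inf \<alpha> \<beta>" for \<alpha> \<beta> :: "nat \<Rightarrow> nat"
    by (rule ext) (simp add: inf_nat_def)
  then show ?thesis using X unfolding property_G1_def elt_set_plus_def by auto
qed

lemma G2_translate:
  assumes "property_G2 d X"
  shows "property_G2 d (\<omega> +o X)"
  unfolding property_G2_def
proof (intro ballI impI, elim conjE)
  fix \<alpha> \<beta> i assume h: "\<alpha> \<in> \<omega> +o X" "\<beta> \<in> \<omega> +o X" "i \<in> {1..d}" "\<alpha> \<noteq> \<beta>" "\<alpha> i = \<beta> i"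
  then obtain a b where ab: "a \<in> X" "b \<in> X" "\<alpha> = \<omega> + a" "\<beta> = \<omega> + b" by (auto simp: elt_set_plus_def)
  then have "a \<noteq> b \<and> a i = b i" using h by auto
  then obtain \<epsilon> where \<epsilon>: "\<epsilon> \<in> X" "\<epsilon> i > a i"
    "\<forall>j\<in>{1..d} - {i}. \<epsilon> j \<ge> min (a j) (b j) \<and> (a j \<noteq> b j \<longrightarrow> \<epsilon> j = min (a j) (b j))"
    using assms ab(1,2) h(3) unfolding property_G2_def by metis
  show "\<exists>\<epsilon>\<in>\<omega> +o X. \<alpha> i < \<epsilon> i \<and> (\<forall>j\<in>{1..d} - {i}. min (\<alpha> j) (\<beta> j) \<le> \<epsilon> j \<and>
      (\<alpha> j \<noteq> \<beta> j \<longrightarrow> \<epsilon> j = min (\<alpha> j) (\<beta> j)))"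
    using \<epsilon> by (intro bexI[of _ "\<omega> + \<epsilon>"]) (auto simp: ab set_plus_intro2 simp flip: min_add_distrib_right)
qed

text \<open>Elements of the translate are at least \<omega>, so no step below \<omega> is effective;
  truncated subtraction is harmless elsewhere because elements of \<open>X\<close> are
  nonnegative.\<close>

lemma step_translate:
  assumes "\<omega> \<in> Nvec d" and "X \<subseteq> Nvec d"
  shows "step (\<omega> +o X) i \<gamma> = (if \<gamma> i < \<omega> i then 0 else step X i (\<lambda>j. \<gamma> j - \<omega> j))"
proof -
  have "(\<exists>\<beta>\<in>\<omega> +o X. \<gamma> \<le> \<beta> \<and> \<beta> i = \<gamma> i) \<longleftrightarrow> (\<exists>\<beta>\<in>X. \<gamma> \<le> \<omega> + \<beta> \<and> \<omega> i + \<beta> i = \<gamma> i)"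
    by (auto simp: elt_set_plus_def)
  also have "\<dots> \<longleftrightarrow> \<not> \<gamma> i < \<omega> i \<and> (\<exists>\<beta>\<in>X. (\<lambda>j. \<gamma> j - \<omega> j) \<le> \<beta> \<and> \<beta> i = \<gamma> i - \<omega> i)"
    by (auto simp: le_fun_def le_diff_conv add.commute)
  finally show ?thesis by (simp add: step_def)
qed

text \<open>A step with \<open>\<xi> i < \<omega> i\<close> neither counts for the translate nor
  moves the truncated difference; the other steps correspond to steps for \<open>X\<close>.\<close>

lemma height_translate:
  assumes \<omega>: "\<omega> \<in> Nvec d" and X: "X \<subseteq> Nvec d" "property_G2 d X" and \<gamma>: "\<gamma> \<in> Nvec d"
  shows "height d (\<omega> +o X) \<gamma> = height d X (\<lambda>i. \<gamma> i - \<omega> i)"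
proof -
  have "(\<lambda>_. 0) \<le> \<gamma>" by (simp add: le_fun_def)
  then show ?thesis using \<gamma>
  proof (induction rule: path_induct)
    case base
    show ?case by (simp add: height_def)
  next
    case (step \<xi> i)
    let ?\<xi> = "\<lambda>j. \<xi> j - \<omega> j"
    have N: "?\<xi> \<in> Nvec d" using step(1) by (auto simp: Nvec_def)
    have "height d (\<omega> +o X) (bump i \<xi>) = height d X ?\<xi> + (if \<xi> i < \<omega> i then 0 else step X i ?\<xi>)"
      using height_bump[OF G2_translate[OF X(2)] step(1,2)] step(5) step_translate[OF \<omega> X(1)]
      by (simp del: fun_upd_apply)
    moreover have "(\<lambda>j. bump i \<xi> j - \<omega> j) = (if \<xi> i < \<omega> i then ?\<xi> else bump i ?\<xi>)"
      by (auto simp: fun_eq_iff)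
    ultimately show ?case
      using height_bump[OF X(2) N step(2)] by (cases "\<xi> i < \<omega> i") (simp_all del: fun_upd_apply)
  qed
qed

text \<open>Exchange argument: the parts of \<open>U\<close> and of \<open>{1..k}\<close> outside
  the other have equal size, and \<open>w k\<close> separates their values.\<close>

lemma sum_le_sum_initial:
  fixes w :: "nat \<Rightarrow> nat"
  assumes mono: "\<And>i j. 1 \<le> i \<Longrightarrow> i \<le> j \<Longrightarrow> j \<le> d \<Longrightarrow> w j \<le> w i"
    and U: "U \<subseteq> {1..d}" "card U = k"
  shows "sum w U \<le> sum w {1..k}"
proof (cases "k = 0")
  case True
  then have "U = {}" using U finite_subset by fastforce
  then show ?thesis by simp
next
  case False
  have fin: "finite U" using U(1) finite_subset by blast
  have k: "k \<le> d" using U card_mono[of "{1..d}" U] by simp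
  have "card (U - {1..k}) = card ({1..k} - U)"
    using U(2) fin card_Diff_subset_Int[of U "{1..k}"] card_Diff_subset_Int[of "{1..k}" U]
    by (simp add: Int_commute)
  moreover have "sum w (U - {1..k}) \<le> card (U - {1..k}) * w k"
    using sum_bounded_above[of "U - {1..k}" w "w k"] mono[of k] U(1) False by force
  moreover have "card ({1..k} - U) * w k \<le> sum w ({1..k} - U)"
    using sum_bounded_below[of "{1..k} - U" "w k" w] mono[of _ k] k by force
  ultimately have "sum w (U - {1..k}) \<le> sum w ({1..k} - U)" by simp
  then show ?thesis
    using sum.Int_Diff[OF fin, of w "{1..k}"] sum.Int_Diff[of "{1..k}" w U] by (simp add: Int_commute)
qed

theorem theorem4p4:
  fixes d :: nat and S E :: "(nat \<Rightarrow> nat) set" and \<omega> :: "nat \<Rightarrow> nat"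
    and s :: "nat \<Rightarrow> nat" and N :: nat
  assumes "good_semigroup d S"
    and "\<omega> \<in> S" and "\<omega> \<noteq> 0"
    and "\<And>i j. 1 \<le> i \<Longrightarrow> i \<le> j \<Longrightarrow> j \<le> d \<Longrightarrow> \<omega> j \<le> \<omega> i"
    and "\<And>k. s k = (\<Sum>j=1..k. \<omega> j)"
    and "E = \<omega> +o S"
    and "N = num_levels d S E"
  shows "(\<forall>k\<in>{1..d}. \<forall>i\<in>{1..N}.
            contains_subspace d E (level d S E i) (d - k) \<longleftrightarrow> int i \<ge> int N - int (s k) + 1)
         \<and> N = s d"
proof -
  have S: "S \<subseteq> Nvec d" "property_G1 S" "property_G2 d S" "property_G3 d S"
    and add: "\<And>\<alpha> \<beta>. \<alpha> \<in> S \<Longrightarrow> \<beta> \<in> S \<Longrightarrow> \<alpha> + \<beta> \<in> S"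
    using assms(1) by (auto simp: good_semigroup_def)
  have \<omega>: "\<omega> \<in> Nvec d" using assms(2) S(1) by blast
  have "E \<subseteq> S" using add assms(2) by (auto simp: assms(6) elt_set_plus_def)
  then have E: "property_G1 E" "property_G2 d E" "E \<subseteq> S"
    using G1_translate[OF S(2)] G2_translate[OF S(3)] by (simp_all add: assms(6))
  obtain c0 where c0: "c0 \<in> S" "c0 +o Nvec d \<subseteq> S" using S(4) by (auto simp: property_G3_def)
  have "\<omega> + c0 \<in> Nvec d" using add assms(2) c0(1) S(1) by blast
  moreover have "(\<omega> + c0) +o Nvec d \<subseteq> E"
    unfolding assms(6) using c0(2) by (auto simp: elt_set_plus_def add.assoc)
  ultimately have c: "conductor d E \<in> Nvec d"
    "\<And>\<gamma>. \<gamma> \<in> Nvec d \<Longrightarrow> conductor d E \<le> \<gamma> \<Longrightarrow> \<gamma> \<in> E"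
    using conductor_props[OF E(1)] by blast+
  define c where "c = conductor d E"
  interpret nested_good d S E c
    using S E c unfolding c_def by unfold_locales
  have c_E: "c \<in> E" using above_c c_Nvec by blast
  then have \<omega>c: "\<omega> \<le> c" using translate_mem_iff[OF \<omega> S(1), of c] assms(6) by simp
  \<comment> \<open>The height for \<open>E\<close> at the corner is that for \<open>S\<close> at
    the truncated difference \<open>?\<gamma>\<close>; from there to the corner every step is
    effective for \<open>S\<close>, so \<open>g\<close> is the length of that stretch.\<close>
  have g_corner: "g (corner U) = int (sum \<omega> ({1..d} - U))" if U: "U \<subseteq> {1..d}" for U
  proof -
    let ?\<gamma> = "\<lambda>i. corner U i - \<omega> i"
    have full: "step S i \<xi> = 1"
      if \<xi>: "\<xi> \<in> Nvec d" "i \<in> {1..d}" "?\<gamma> \<le> \<xi>" "bump i \<xi> \<le> corner U" for \<xi> i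
    proof -
      have "\<xi> i < corner U i" using \<xi>(4) unfolding bump_le_iff by blast
      then have "i \<notin> U" by (auto simp: corner_def)
      then have ci: "c i - \<omega> i \<le> \<xi> i" using le_funD[OF \<xi>(3), of i] by (simp add: corner_def)
      \<comment> \<open>Lifting to at least \<open>c - \<omega>\<close> puts
        \<open>\<omega> + \<beta>\<close> beyond \<open>c\<close>, hence \<beta> in
        \<open>S\<close>, and leaves coordinate i alone.\<close>
      define \<beta> where "\<beta> = (\<lambda>j. max (\<xi> j) (c j - \<omega> j))"
      have "c j \<le> \<omega> j + max (\<xi> j) (c j - \<omega> j)" for j by linarith
      then have "c \<le> \<omega> + \<beta>" by (simp add: \<beta>_def le_fun_def)
      moreover have "\<omega> + \<beta> \<in> Nvec d" using \<omega> \<xi>(1) c_Nvec by (auto simp: \<beta>_def Nvec_def)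
      ultimately have "\<omega> + \<beta> \<in> E" using above_c by blast
      then have "\<beta> \<in> S" unfolding assms(6) translate_mem_iff[OF \<omega> S(1)] by simp
      moreover have "\<xi> \<le> \<beta>" "\<beta> i = \<xi> i" using ci by (auto simp: \<beta>_def le_fun_def)
      ultimately have "\<exists>\<beta>\<in>S. \<xi> \<le> \<beta> \<and> \<beta> i = \<xi> i" by blast
      then show ?thesis by (simp add: step_def)
    qed
    have hS: "height d S (corner U) = height d S ?\<gamma> + (\<Sum>i\<in>{1..d}. int (corner U i) - int (?\<gamma> i))"
      by (rule height_full_steps[OF S(3) _ corner_Nvec full]) (simp add: le_fun_def)
    have hE: "height d E (corner U) = height d S ?\<gamma>"
      unfolding assms(6) using height_translate[OF \<omega> S(1,3) corner_Nvec] .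
    have "int (corner U i) - int (?\<gamma> i) = (if i \<in> {1..d} - U then int (\<omega> i) else 0)"
      if "i \<in> {1..d}" for i
      using le_funD[OF \<omega>c, of i] that by (auto simp: corner_def of_nat_diff)
    then have "(\<Sum>i\<in>{1..d}. int (corner U i) - int (?\<gamma> i)) =
        (\<Sum>i\<in>{1..d}. if i \<in> {1..d} - U then int (\<omega> i) else 0)"
      by (intro sum.cong) auto
    also have "\<dots> = (\<Sum>i\<in>{1..d} - U. int (\<omega> i))"
      by (rule sum.mono_neutral_cong_right) auto
    finally show ?thesis unfolding g_def hS hE by simp
  qed
  \<comment> \<open>The empty set gives no subspace, but it evaluates \<open>g\<close> at
    \<open>c\<close>, which is \<open>N\<close>.\<close>
  have "corner {} = c" by (simp add: corner_def)
  then have N: "int N = int (s d)"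
    using g_corner[of "{}"] num_levels_eq assms(5,7) by simp
  have g_corner': "g (corner U) = int N - int (sum \<omega> U)" if U: "U \<subseteq> {1..d}" for U
    using g_corner[OF U] sum.subset_diff[OF U, of \<omega>] N assms(5)[of d] by simp
  have "contains_subspace d E (level d S E i) (d - k) \<longleftrightarrow> int i \<ge> int N - int (s k) + 1"
    if k: "k \<in> {1..d}" and i: "i \<in> {1..N}" for k i
  proof -
    have "contains_subspace d E (level d S E i) (d - k) \<longleftrightarrow>
        (\<exists>U. U \<noteq> {} \<and> U \<subseteq> {1..d} \<and> d - k = d - card U \<and> g (corner U) \<le> int i - 1)"
      using contains_subspace_level_iff[OF c_def] i assms(7) by blast
    also have "\<dots> \<longleftrightarrow> int N - int (s k) \<le> int i - 1"
    proof
      assume "\<exists>U. U \<noteq> {} \<and> U \<subseteq> {1..d} \<and> d - k = d - card U \<and> g (corner U) \<le> int i - 1"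
      then obtain U where U: "U \<subseteq> {1..d}" "d - k = d - card U" "g (corner U) \<le> int i - 1" by blast
      \<comment> \<open>Subtraction is truncated: \<open>d - k\<close> determines k because both
        sizes are at most d.\<close>
      have "card U \<le> d" using card_mono[OF _ U(1)] by simp
      then have "card U = k" using U(2) k unfolding atLeastAtMost_iff by linarith
      then have "sum \<omega> U \<le> s k" using sum_le_sum_initial[OF assms(4) U(1)] assms(5) by simp
      then show "int N - int (s k) \<le> int i - 1" using U(3) g_corner'[OF U(1)] by linarith
    next
      assume "int N - int (s k) \<le> int i - 1"
      \<comment> \<open>The first k coordinates carry the largest sum of \<omega>, hence the least
        corner value.\<close>
      then show "\<exists>U. U \<noteq> {} \<and> U \<subseteq> {1..d} \<and> d - k = d - card U \<and> g (corner U) \<le> int i - 1"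
        using k g_corner'[of "{1..k}"] assms(5)[of k] by (intro exI[of _ "{1..k}"]) auto
    qed
    finally show ?thesis by linarith
  qed
  then show ?thesis using N by simp
qed

end
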